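(* Let $0<p\le\infty$, $0<q_0\le q_1\le\infty$, $0<r_1\le r_0\le\infty$ and $\beta\in\mathbb{R}$. Then there is the continuous embedding $$\mathrm T^{p,q_0,r_0}_\beta\hookrightarrow\mathrm T^{p,q_1,r_1}_\beta.$$
   Context: The symbol ⨍ denotes the mean-value integral and $B(x,t)$ the open ball in $\mathbb{R}^d$; $\mathbb{R}^{d+1}_+=(0,\infty)\times\mathbb{R}^d$. For $0<r\le\infty$, $\beta\in\mathbb{R}$ and measurable $f$ on $\mathbb{R}^{d+1}_+$ write $W_{r,\beta}f(t,x)=\big(⨍_{t/2}^t⨍_{B(x,t)}|s^{-\beta}f(s,y)|^r\,\mathrm{d}y\,\mathrm{d}s\big)^{1/r}$ (essential supremum of $|s^{-\beta}f(s,y)|$ over $(\frac t2,t]\times B(x,t)$ if $r=\infty$). For $0<p,q,r\le\infty$ the tent space $\mathrm T^{p,q,r}_\beta$ is the set of measurable $f$ with finite (quasi-)norm, where $$\|f\|_{\mathrm T^{p,q,r}_\beta}=\Big\|\Big(\int_0^\infty (W_{r,\beta}f(t,\cdot))^q\frac{\mathrm{d}t}{t}\Big)^{1/q}\Big\|_{L^p(\mathbb{R}^d)}\quad(p<\infty),$$ with $\operatorname{ess\,sup}_{t>0}$ in place of the $t$-integral if $q=\infty$; $$\|f\|_{\mathrm T^{\infty,q,r}_\beta}=\sup_{\tau>0}\sup_{y\in\mathbb{R}^d}\Big(\int_0^\tau⨍_{B(y,\tau)}(W_{r,\beta}f(t,x))^q\frac{\mathrm{d}x\,\mathrm{d}t}{t}\Big)^{1/q}\quad(q<\infty),\qquad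 \|f\|_{\mathrm T^{\infty,\infty,r}_\beta}=\sup_{t>0}\sup_{x\in\mathbb{R}^d}W_{r,\beta}f(t,x).$$ *)

theory Defs
  imports "HOL-Analysis.Analysis" "HOL-Probability.Essential_Supremum"
begin

(* R^d is an arbitrary euclidean_space 'a; the first coordinate of real * 'a is the
   variable t. Exponents in (0,\<infinity>] are of type ennreal. *)

definition upper_half_space :: "(real \<times> 'a::euclidean_space) set" where
  "upper_half_space = {0<..} \<times> UNIV"

(* Only used for exponents a > 0, so that \<infinity> to the power a is \<infinity>
   (and 0 to the power a is 0). *)
definition ennreal_powr :: "ennreal \<Rightarrow> real \<Rightarrow> ennreal" where
  "ennreal_powr u a = (if u = \<infinity> then \<infinity> else ennreal (enn2real u powr a))"

definition mean_integral :: "'b::euclidean_space set \<Rightarrow> ('b \<Rightarrow> ennreal) \<Rightarrow> ennreal" where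
  "mean_integral A h = (\<integral>\<^sup>+x\<in>A. h x \<partial>lebesgue) / emeasure lebesgue A"

definition whitney_mean ::
  "ennreal \<Rightarrow> real \<Rightarrow> (real \<times> 'a::euclidean_space \<Rightarrow> complex) \<Rightarrow> real \<Rightarrow> 'a \<Rightarrow> ennreal" where
  "whitney_mean r \<beta> f t x =
    (if r = \<infinity>
     then esssup (lebesgue_on ({t/2<..t} \<times> ball x t))
            (\<lambda>(s, y). ennreal (norm (of_real (s powr (-\<beta>)) * f (s, y))))
     else ennreal_powr
            (mean_integral {t/2<..t} (\<lambda>s. mean_integral (ball x t)
               (\<lambda>y. ennreal (norm (of_real (s powr (-\<beta>)) * f (s, y)) powr enn2real r))))
            (1 / enn2real r))"

definition vertical_functional ::
  "ennreal \<Rightarrow> ennreal \<Rightarrow> real \<Rightarrow> (real \<times> 'a::euclidean_space \<Rightarrow> complex) \<Rightarrow> 'a \<Rightarrow> ennreal" where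
  "vertical_functional q r \<beta> f x =
    (if q = \<infinity>
     then esssup (lebesgue_on {0<..}) (\<lambda>t. whitney_mean r \<beta> f t x)
     else ennreal_powr
            (\<integral>\<^sup>+t\<in>{0<..}. ennreal_powr (whitney_mean r \<beta> f t x) (enn2real q) * ennreal (1 / t) \<partial>lebesgue)
            (1 / enn2real q))"

definition tent_norm ::
  "ennreal \<Rightarrow> ennreal \<Rightarrow> ennreal \<Rightarrow> real \<Rightarrow> (real \<times> 'a::euclidean_space \<Rightarrow> complex) \<Rightarrow> ennreal" where
  "tent_norm p q r \<beta> f =
    (if p < \<infinity>
     then ennreal_powr
            (\<integral>\<^sup>+x. ennreal_powr (vertical_functional q r \<beta> f x) (enn2real p) \<partial>lebesgue)
            (1 / enn2real p)
     else if q < \<infinity>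
     then (SUP \<tau>\<in>{0<..}. SUP y. ennreal_powr
            (\<integral>\<^sup>+t\<in>{0<..<\<tau>}. mean_integral (ball y \<tau>)
               (\<lambda>x. ennreal_powr (whitney_mean r \<beta> f t x) (enn2real q)) * ennreal (1 / t) \<partial>lebesgue)
            (1 / enn2real q))
     else (SUP t\<in>{0<..}. SUP x. whitney_mean r \<beta> f t x))"

(* Functions are not identified when they agree almost everywhere; tent_norm depends only
   on the almost-everywhere class. Values of f outside the half space play no role. *)
definition tent_space ::
  "ennreal \<Rightarrow> ennreal \<Rightarrow> ennreal \<Rightarrow> real \<Rightarrow> (real \<times> 'a::euclidean_space \<Rightarrow> complex) set" where
  "tent_space p q r \<beta> =
    {f. f \<in> borel_measurable (lebesgue_on upper_half_space) \<and> tent_norm p q r \<beta> f < \<infinity>}"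

(* The inclusion map is well defined and bounded with respect to the (quasi-)norms NX and NY. *)
definition continuously_embedded ::
  "'v set \<Rightarrow> ('v \<Rightarrow> ennreal) \<Rightarrow> 'v set \<Rightarrow> ('v \<Rightarrow> ennreal) \<Rightarrow> bool" where
  "continuously_embedded X NX Y NY \<longleftrightarrow>
    X \<subseteq> Y \<and> (\<exists>C::real. \<forall>f\<in>X. NY f \<le> ennreal C * NX f)"

end

theory Submission
  imports Defs
begin

text \<open>
  Lowering \<open>r\<close> decreases each Whitney mean by Jensen's inequality. For \<open>q\<close>, cut a Whitney box
  into boundedly many small pieces: one of them carries a fixed proportion of the mean, hence a
  large mean at \<open>(t, x)\<close> forces comparable means at all \<open>(s, y)\<close> with \<open>y\<close> in some ball of
  radius \<open>t/4\<close> near \<open>x\<close> and \<open>s\<close> in an interval of length \<open>t/4\<close>. For \<open>p = \<infinity>\<close> this bounds the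
  supremum of the means by a single Carleson integral. For \<open>p < \<infinity>\<close> a pointwise bound at \<open>x\<close>
  fails, since that ball need not contain \<open>x\<close>, but the Vitali covering lemma compares the level
  sets of the nontangential maximal function with those of the vertical functional, which gives
  the bound in \<open>L\<^sup>p\<close>. This settles \<open>q\<^sub>1 = \<infinity>\<close>, and finite \<open>q\<^sub>1\<close> follows by interpolating between
  the supremum and the \<open>q\<^sub>0\<close>-functional.
\<close>

subsection \<open>Powers with values in the extended reals\<close>

text \<open>A Whitney box never fits as a whole into a neighbouring one: \<open>{t/2<..t}\<close>
  lies in \<open>{s/2<..s}\<close> only for s = t. Only a piece of smaller height and width lies in
  all boxes over a region of size comparable to t, which is why the mass must first be located in
  one piece, and why the resulting ball may miss x. Comparing measures of level sets, one level at a
  time, makes the estimate work for every finite p > 0; boundedness of a maximal operator on L^p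
  would exclude small p. Interpolation loses no constant: once the supremum and the q0-functional
  obey the same bound m, so does the q1-functional. Hence the constant does not depend on q1. A
  second obstacle is measurability. A Lebesgue measurable f may have nonmeasurable sections at
  exceptional heights, so the weighted norm of f is replaced by a Borel function, and the later
  estimates are arranged to hold for arbitrary functions wherever possible.\<close>

lemma ennreal_powr_ennreal [simp]: "0 \<le> x \<Longrightarrow> ennreal_powr (ennreal x) a = ennreal (x powr a)"
  by (simp add: ennreal_powr_def)

lemma ennreal_powr_top [simp]: "ennreal_powr \<infinity> a = \<infinity>" "ennreal_powr top a = \<infinity>"
  by (simp_all add: ennreal_powr_def)

lemma ennreal_powr_0 [simp]: "ennreal_powr 0 a = 0"
  by (simp add: ennreal_powr_def)

lemma measurable_ennreal_powr [measurable]: "(\<lambda>u. ennreal_powr u a) \<in> borel_measurable borel"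
  unfolding ennreal_powr_def by measurable

lemma ennreal_powr_mono: "0 \<le> a \<Longrightarrow> u \<le> v \<Longrightarrow> ennreal_powr u a \<le> ennreal_powr v a"
  by (cases u; cases v) (auto simp: ennreal_le_iff top_unique intro!: powr_mono2 ennreal_leI)

lemma ennreal_powr_powr: "ennreal_powr (ennreal_powr u a) b = ennreal_powr u (a * b)"
  by (cases u) (auto simp: powr_powr)

lemma ennreal_powr_one [simp]: "ennreal_powr u 1 = u"
  by (cases u) auto

lemma ennreal_powr_inverse:
  "a \<noteq> 0 \<Longrightarrow> ennreal_powr (ennreal_powr u a) (1 / a) = u"
  "a \<noteq> 0 \<Longrightarrow> ennreal_powr (ennreal_powr u (1 / a)) a = u"
  by (simp_all add: ennreal_powr_powr)

lemma ennreal_powr_cmult: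
  "0 \<le> c \<Longrightarrow> ennreal_powr (ennreal c * u) a = ennreal (c powr a) * ennreal_powr u a"
  by (cases u; cases "c = 0")
    (auto simp: ennreal_mult[symmetric] powr_mult ennreal_mult_top)

lemma ennreal_powr_le_iff:
  assumes "0 < a"
  shows "ennreal_powr u (1 / a) \<le> v \<longleftrightarrow> u \<le> ennreal_powr v a"
proof
  assume "ennreal_powr u (1 / a) \<le> v"
  then have "ennreal_powr (ennreal_powr u (1 / a)) a \<le> ennreal_powr v a"
    using assms by (intro ennreal_powr_mono) auto
  then show "u \<le> ennreal_powr v a"
    using assms by (simp add: ennreal_powr_inverse)
next
  assume "u \<le> ennreal_powr v a"
  then have "ennreal_powr u (1 / a) \<le> ennreal_powr (ennreal_powr v a) (1 / a)"
    using assms by (intro ennreal_powr_mono) auto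
  then show "ennreal_powr u (1 / a) \<le> v"
    using assms by (simp add: ennreal_powr_inverse)
qed

lemma le_ennreal_powr_iff:
  assumes "0 < a"
  shows "u \<le> ennreal_powr v (1 / a) \<longleftrightarrow> ennreal_powr u a \<le> v"
  using ennreal_powr_le_iff[of "1 / a" u v] assms by simp

lemma enn2real_exponent_pos: "0 < r \<Longrightarrow> r \<noteq> \<infinity> \<Longrightarrow> 0 < enn2real r"
  by (cases r) auto

subsection \<open>Means over sets\<close>

text \<open>One integral over a set in the product replaces the iterated means of
  \<open>whitney_mean\<close>, and \<open>lborel\<close> replaces the completed measure. An
  arbitrary set \<open>A\<close> is allowed so that boxes and supersets of their pieces are treated
  alike.\<close>

definition local_mean :: "ennreal \<Rightarrow> ('b::euclidean_space \<Rightarrow> real) \<Rightarrow> 'b set \<Rightarrow> ennreal" where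
  "local_mean r g A =
    (if r = \<infinity> then esssup (restrict_space lborel A) (\<lambda>w. ennreal (g w))
     else ennreal_powr ((\<integral>\<^sup>+w\<in>A. ennreal (g w powr enn2real r) \<partial>lborel) / emeasure lborel A)
            (1 / enn2real r))"

text \<open>\<open>esssup\<close> is the infimum of the almost everywhere bounds for a measurable
  function and \<open>top\<close> otherwise, so measurability gives the implication from right to
  left. The case r = \<infinity> is handled through upper bounds alone, as
  \<open>local_mean_le_iff\<close> does for finite r.\<close>

lemma local_mean_top_le_iff:
  fixes g :: "'b::euclidean_space \<Rightarrow> real"
  assumes [measurable]: "g \<in> borel_measurable borel" "A \<in> sets borel"
  shows "local_mean \<infinity> g A \<le> z \<longleftrightarrow> (AE w in lborel. w \<in> A \<longrightarrow> ennreal (g w) \<le> z)"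
proof -
  have AE_iff: "(AE w in restrict_space lborel A. P w) \<longleftrightarrow> (AE w in lborel. w \<in> A \<longrightarrow> P w)" for P
    by (rule AE_restrict_space_iff) simp
  have meas: "(\<lambda>w. ennreal (g w)) \<in> borel_measurable (restrict_space lborel A)"
    by (rule measurable_restrict_space1) measurable
  show ?thesis
  proof
    assume le: "local_mean \<infinity> g A \<le> z"
    have "AE w in restrict_space lborel A. ennreal (g w) \<le> z"
      using esssup_AE[of "\<lambda>w. ennreal (g w)" "restrict_space lborel A"]
      by eventually_elim (use le in \<open>auto simp: local_mean_def\<close>)
    then show "AE w in lborel. w \<in> A \<longrightarrow> ennreal (g w) \<le> z"
      by (simp add: AE_iff)
  next
    assume "AE w in lborel. w \<in> A \<longrightarrow> ennreal (g w) \<le> z"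
    then show "local_mean \<infinity> g A \<le> z"
      using meas by (auto simp: local_mean_def AE_iff)
  qed
qed

lemma divide_le_iff_ennreal:
  fixes a b c :: ennreal
  shows "b \<noteq> 0 \<Longrightarrow> b < \<infinity> \<Longrightarrow> a / b \<le> c \<longleftrightarrow> a \<le> c * b"
proof -
  assume b: "b \<noteq> 0" "b < \<infinity>"
  have "a / b * b = a" "c * b / b = c"
    using b by (simp_all add: ennreal_divide_times ennreal_mult_divide_eq)
  then show ?thesis
    by (metis divide_right_mono_ennreal mult_right_mono zero_le)
qed

lemma local_mean_le_iff:
  assumes "0 < r" "r \<noteq> \<infinity>" "0 < emeasure lborel A" "emeasure lborel A < \<infinity>" "0 \<le> m"
  shows "local_mean r g A \<le> ennreal m \<longleftrightarrow>
    (\<integral>\<^sup>+w\<in>A. ennreal (g w powr enn2real r) \<partial>lborel) \<le> ennreal (m powr enn2real r) * emeasure lborel A"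
  using assms enn2real_exponent_pos[of r]
  by (simp add: local_mean_def ennreal_powr_le_iff divide_le_iff_ennreal)

text \<open>Jensen's inequality for the normalised measure on \<open>A\<close>. Comparing with
  values \<open>y\<close> strictly above the larger mean avoids the means 0 and \<infinity>: such a
  \<open>y\<close> is \<infinity> or a positive real m by which \<open>g\<close> can be
  scaled.\<close>

lemma local_mean_mono_exponent:
  fixes g :: "'b::euclidean_space \<Rightarrow> real"
  assumes [measurable]: "g \<in> borel_measurable borel" "A \<in> sets borel"
    and nonneg: "\<And>w. 0 \<le> g w"
    and A: "0 < emeasure lborel A" "emeasure lborel A < \<infinity>"
    and r: "0 < r1" "r1 \<le> r0"
  shows "local_mean r1 g A \<le> local_mean r0 g A"
proof (rule dense_ge)
  fix y assume y: "local_mean r0 g A < y"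
  show "local_mean r1 g A \<le> y"
  proof (cases "y = \<infinity> \<or> r1 = \<infinity>")
    case True
    then show ?thesis using r y by (auto simp: top_unique)
  next
    case False
    then obtain m where m: "y = ennreal m" "0 \<le> m" by (cases y) auto
    have m0: "0 < m" using y m by (cases "m = 0") auto
    have le: "local_mean r0 g A \<le> ennreal m" using y m by simp
    define b where "b = enn2real r1"
    have b: "0 < b" using False r by (simp add: b_def enn2real_exponent_pos)
    have "(\<integral>\<^sup>+w\<in>A. ennreal (g w powr b) \<partial>lborel) \<le> ennreal (m powr b) * emeasure lborel A"
    proof (cases "r0 = \<infinity>")
      case True
      then have "AE w in lborel. w \<in> A \<longrightarrow> ennreal (g w) \<le> ennreal m"
        using le local_mean_top_le_iff[of g A "ennreal m"] by simp
      then have "AE w in lborel. ennreal (g w powr b) * indicator A w \<le> ennreal (m powr b) * indicator A w"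
        by eventually_elim
          (use m b nonneg in \<open>auto simp: ennreal_le_iff indicator_def intro!: ennreal_leI powr_mono2\<close>)
      from nn_integral_mono_AE[OF this] show ?thesis
        by (simp add: nn_integral_cmult_indicator)
    next
      case fin: False
      define a where "a = enn2real r0"
      have a: "0 < a" using fin r by (simp add: a_def enn2real_exponent_pos)
      have ba: "b \<le> a" using fin r unfolding a_def b_def
        by (intro enn2real_mono) (auto simp: top.not_eq_extremum)
      have int: "(\<integral>\<^sup>+w\<in>A. ennreal (g w powr a) \<partial>lborel) \<le> ennreal (m powr a) * emeasure lborel A"
        using le local_mean_le_iff[of r0 A m g] fin r A m by (simp add: a_def)
      define th where "th = b / a"
      have th: "0 < th" "th \<le> 1" "a * th = b" using a b ba by (auto simp: th_def)
      \<comment> \<open>The tangent at u = 1 of the concave power, u^th \<le> th u + 1 - th, for u =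
        (g w / m)^a. Multiplied by m^b it is affine in (g w)^a and can be integrated over
        \<open>A\<close>.\<close>
      have pointwise: "g w powr b \<le> m powr b * (1 - th) + m powr b * th / m powr a * g w powr a" for w
      proof (cases "g w = 0")
        case True
        then show ?thesis using m0 th b by simp
      next
        case False
        then have g0: "0 < g w" using nonneg[of w] by simp
        have "(g w powr a / m powr a) powr th * 1 powr (1 - th)
            \<le> th * (g w powr a / m powr a) + (1 - th) * 1"
          using th g0 m0 by (intro Youngs_inequality_0) auto
        then have "m powr b * (g w powr b / m powr b)
            \<le> m powr b * (th * (g w powr a / m powr a) + (1 - th))"
          using g0 m0 th by (intro mult_left_mono) (auto simp: powr_divide powr_powr)
        then show ?thesis using m0 by (simp add: algebra_simps)
      qed
      \<comment> \<open>Replacing the mean of g^a by its bound m^a turns the affine bound into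
        exactly m^b, so no factor is lost.\<close>
      define c1 where "c1 = m powr b * (1 - th)"
      define c2 where "c2 = m powr b * th / m powr a"
      have c: "0 \<le> c1" "0 \<le> c2" "c1 + c2 * m powr a = m powr b"
        using th m0 by (auto simp: c1_def c2_def algebra_simps)
      have pointwise_ennreal: "ennreal (g w powr b) \<le> ennreal c1 + ennreal c2 * ennreal (g w powr a)" for w
        using ennreal_leI[OF pointwise[of w]] c(1,2) unfolding c1_def[symmetric] c2_def[symmetric]
        by (simp add: ennreal_mult)
      have "(\<integral>\<^sup>+w\<in>A. ennreal (g w powr b) \<partial>lborel)
          \<le> (\<integral>\<^sup>+w. ennreal c1 * indicator A w + ennreal c2 * (ennreal (g w powr a) * indicator A w) \<partial>lborel)"
        using pointwise_ennreal by (intro nn_integral_mono) (simp add: indicator_def)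
      also have "\<dots> = ennreal c1 * emeasure lborel A
          + ennreal c2 * (\<integral>\<^sup>+w\<in>A. ennreal (g w powr a) \<partial>lborel)"
        by (simp add: nn_integral_add nn_integral_cmult nn_integral_cmult_indicator)
      also have "\<dots> \<le> ennreal c1 * emeasure lborel A
          + ennreal c2 * (ennreal (m powr a) * emeasure lborel A)"
        using int by (intro add_left_mono mult_left_mono) auto
      also have "\<dots> = (ennreal c1 + ennreal c2 * ennreal (m powr a)) * emeasure lborel A"
        by (simp add: algebra_simps)
      also have "ennreal c1 + ennreal c2 * ennreal (m powr a) = ennreal (m powr b)"
        using c by (simp add: ennreal_mult[symmetric] ennreal_plus[symmetric] del: ennreal_plus)
      finally show ?thesis .
    qed
    then show ?thesis
      using local_mean_le_iff[of r1 A m g] False r A m by (simp add: b_def)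
  qed
qed

text \<open>Pigeonhole: if every piece had some admissible superset with a small mean, summing the
  integrals over these supersets would contradict the mean over \<open>A\<close>. The index i is
  chosen before \<open>A'\<close>, so that one piece serves all supersets at once; \<kappa> is
  chosen before \<open>g\<close>, \<open>A\<close>, \<open>B\<close> and \<open>l\<close>.\<close>

lemma local_mean_cover:
  fixes I :: "'i set"
  assumes r: "0 < r" and K: "0 < K" and I: "finite I" "I \<noteq> {}"
  obtains \<kappa> :: real where "0 < \<kappa>" and
    "\<And>(g :: 'b::euclidean_space \<Rightarrow> real) A B l.
      g \<in> borel_measurable borel \<Longrightarrow> A \<in> sets borel \<Longrightarrow> (\<And>i. i \<in> I \<Longrightarrow> B i \<in> sets borel) \<Longrightarrow>
      A \<subseteq> (\<Union>i\<in>I. B i) \<Longrightarrow> 0 < emeasure lborel A \<Longrightarrow> emeasure lborel A < \<infinity> \<Longrightarrow> 0 < l \<Longrightarrow>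
      ennreal l < local_mean r g A \<Longrightarrow>
      \<exists>i\<in>I. \<forall>A'. A' \<in> sets borel \<longrightarrow> B i \<subseteq> A' \<longrightarrow> 0 < emeasure lborel A' \<longrightarrow>
        emeasure lborel A' \<le> ennreal K * emeasure lborel A \<longrightarrow> ennreal (\<kappa> * l) \<le> local_mean r g A'"
proof
  define n where "n = real (card I)"
  have n: "0 < n" using I by (simp add: n_def card_gt_0_iff)
  \<comment> \<open>n sets of measure at most K |A|, each with mean at most \<kappa> l, give an
    integral of at most n K (\<kappa> l)^r |A|; this \<kappa> turns it into l^r |A|. For r =
    \<infinity> the number and size of the sets do not matter.\<close>
  define \<kappa> where "\<kappa> = (if r = \<infinity> then 1 else (1 / (n * K)) powr (1 / enn2real r))"
  show "0 < \<kappa>" using n K by (simp add: \<kappa>_def)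
  fix g :: "'b \<Rightarrow> real" and A and B :: "'i \<Rightarrow> 'b set" and l :: real
  assume [measurable]: "g \<in> borel_measurable borel" "A \<in> sets borel"
    and Bm: "\<And>i. i \<in> I \<Longrightarrow> B i \<in> sets borel"
    and cov: "A \<subseteq> (\<Union>i\<in>I. B i)" and A: "0 < emeasure lborel A" "emeasure lborel A < \<infinity>"
    and l: "0 < l" and less: "ennreal l < local_mean r g A"
  show "\<exists>i\<in>I. \<forall>A'. A' \<in> sets borel \<longrightarrow> B i \<subseteq> A' \<longrightarrow> 0 < emeasure lborel A' \<longrightarrow>
        emeasure lborel A' \<le> ennreal K * emeasure lborel A \<longrightarrow> ennreal (\<kappa> * l) \<le> local_mean r g A'"
  proof (rule ccontr)
    assume "\<not> ?thesis"
    then have "\<forall>i\<in>I. \<exists>A'. A' \<in> sets borel \<and> B i \<subseteq> A' \<and> 0 < emeasure lborel A' \<and>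
        emeasure lborel A' \<le> ennreal K * emeasure lborel A \<and> local_mean r g A' \<le> ennreal (\<kappa> * l)"
      by (meson linear)
    then obtain A' where A': "\<And>i. i \<in> I \<Longrightarrow> A' i \<in> sets borel" "\<And>i. i \<in> I \<Longrightarrow> B i \<subseteq> A' i"
        "\<And>i. i \<in> I \<Longrightarrow> 0 < emeasure lborel (A' i)"
        "\<And>i. i \<in> I \<Longrightarrow> emeasure lborel (A' i) \<le> ennreal K * emeasure lborel A"
        "\<And>i. i \<in> I \<Longrightarrow> local_mean r g (A' i) \<le> ennreal (\<kappa> * l)"
      by metis
    have "local_mean r g A \<le> ennreal l"
    proof (cases "r = \<infinity>")
      case True
      have "AE w in lborel. \<forall>i\<in>I. w \<in> A' i \<longrightarrow> ennreal (g w) \<le> ennreal l"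
      proof (rule AE_finite_allI[OF I(1)])
        fix i assume "i \<in> I"
        then show "AE w in lborel. w \<in> A' i \<longrightarrow> ennreal (g w) \<le> ennreal l"
          using A'[of i] local_mean_top_le_iff[of g "A' i" "ennreal l"] True by (simp add: \<kappa>_def)
      qed
      then have "AE w in lborel. w \<in> A \<longrightarrow> ennreal (g w) \<le> ennreal l"
        by eventually_elim (use cov A'(2) in blast)
      then show ?thesis using True local_mean_top_le_iff[of g A "ennreal l"] by simp
    next
      case False
      define a where "a = enn2real r"
      have a: "0 < a" using False r by (simp add: a_def enn2real_exponent_pos)
      have \<kappa>a: "(\<kappa> * l) powr a * (n * K) = l powr a"
        using a n K l False by (simp add: \<kappa>_def a_def[symmetric] powr_mult powr_powr)
      have fin: "emeasure lborel (A' i) < \<infinity>" if "i \<in> I" for i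
        using A'(4)[OF that] A by (auto intro: le_less_trans simp: ennreal_mult_less_top)
      have "(\<integral>\<^sup>+w\<in>A. ennreal (g w powr a) \<partial>lborel)
          \<le> (\<integral>\<^sup>+w. (\<Sum>i\<in>I. ennreal (g w powr a) * indicator (A' i) w) \<partial>lborel)"
      proof (intro nn_integral_mono)
        fix w
        show "ennreal (g w powr a) * indicator A w \<le> (\<Sum>i\<in>I. ennreal (g w powr a) * indicator (A' i) w)"
        proof (cases "w \<in> A")
          case True
          then obtain i where i: "i \<in> I" "w \<in> A' i" using cov A'(2) by blast
          have "ennreal (g w powr a) * indicator (A' i) w
              \<le> (\<Sum>i\<in>I. ennreal (g w powr a) * indicator (A' i) w)"
            using i I by (intro member_le_sum) auto
          then show ?thesis using i True by simp
        qed simp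
      qed
      also have "\<dots> = (\<Sum>i\<in>I. \<integral>\<^sup>+w\<in>A' i. ennreal (g w powr a) \<partial>lborel)"
        using A'(1) by (intro nn_integral_sum) auto
      also have "\<dots> \<le> (\<Sum>i\<in>I. ennreal ((\<kappa> * l) powr a) * (ennreal K * emeasure lborel A))"
      proof (intro sum_mono)
        fix i assume i: "i \<in> I"
        have "(\<integral>\<^sup>+w\<in>A' i. ennreal (g w powr a) \<partial>lborel)
            \<le> ennreal ((\<kappa> * l) powr a) * emeasure lborel (A' i)"
          using local_mean_le_iff[of r "A' i" "\<kappa> * l" g] False r A'[OF i] fin[OF i] \<open>0 < \<kappa>\<close> l
          by (simp add: a_def)
        also have "\<dots> \<le> ennreal ((\<kappa> * l) powr a) * (ennreal K * emeasure lborel A)"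
          using A'(4)[OF i] by (intro mult_left_mono) auto
        finally show "(\<integral>\<^sup>+w\<in>A' i. ennreal (g w powr a) \<partial>lborel)
            \<le> ennreal ((\<kappa> * l) powr a) * (ennreal K * emeasure lborel A)" .
      qed
      also have "\<dots> = ennreal ((\<kappa> * l) powr a * (n * K)) * emeasure lborel A"
        using K n by (simp add: n_def ennreal_of_nat_eq_real_of_nat ennreal_mult mult_ac)
      also have "\<dots> = ennreal (l powr a) * emeasure lborel A" by (simp add: \<kappa>a)
      finally show ?thesis
        using local_mean_le_iff[of r A l g] False r A l by (simp add: a_def)
    qed
    with less show False by simp
  qed
qed

subsection \<open>Whitney boxes\<close>

definition whitney_box :: "real \<Rightarrow> 'a::euclidean_space \<Rightarrow> (real \<times> 'a) set" where
  "whitney_box t x = {t/2<..t} \<times> ball x t"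

lemma whitney_box_borel [measurable]: "whitney_box t x \<in> sets borel"
  unfolding whitney_box_def by (rule borel_Times) auto

lemma emeasure_lborel_Times:
  fixes A :: "'a::euclidean_space set" and B :: "'b::euclidean_space set"
  assumes "A \<in> sets borel" "B \<in> sets borel"
  shows "emeasure lborel (A \<times> B) = emeasure lborel A * emeasure lborel B"
  using assms lborel.emeasure_pair_measure_Times[of A lborel B] by (simp add: lborel_prod)

lemma emeasure_whitney_box:
  fixes x :: "'a::euclidean_space"
  assumes "0 < t"
  shows "emeasure lborel (whitney_box t x) = ennreal (unit_ball_vol DIM('a) / 2 * t ^ (DIM('a) + 1))"
proof -
  have "emeasure lborel (whitney_box t x) = ennreal (t / 2) * ennreal (unit_ball_vol DIM('a) * t ^ DIM('a))"
    using assms unfolding whitney_box_def by (simp add: emeasure_lborel_Times emeasure_ball)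
  also have "\<dots> = ennreal (t / 2 * (unit_ball_vol DIM('a) * t ^ DIM('a)))"
    using assms by (intro ennreal_mult[symmetric]) auto
  finally show ?thesis by (simp add: algebra_simps)
qed

lemma emeasure_whitney_box_pos_finite:
  assumes "0 < t"
  shows "0 < emeasure lborel (whitney_box t x)" "emeasure lborel (whitney_box t x) < \<infinity>"
  using assms by (simp_all add: emeasure_whitney_box)

text \<open>Tonelli in the parameter z, since the indicator of the box is jointly measurable in z
  and the integration point.\<close>

lemma local_mean_whitney_box_measurable:
  fixes g :: "real \<times> 'a::euclidean_space \<Rightarrow> real"
  assumes g [measurable]: "g \<in> borel_measurable borel"
  shows "(\<lambda>z. local_mean r g (whitney_box (fst z) (snd z))) \<in> borel_measurable borel"
proof -
  have ind [measurable]: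
    "(\<lambda>p :: (real \<times> 'a) \<times> (real \<times> 'a). indicator (whitney_box (fst (fst p)) (snd (fst p))) (snd p) :: ennreal)
      \<in> borel_measurable (borel \<Otimes>\<^sub>M borel)"
  proof -
    have "(\<lambda>p :: (real \<times> 'a) \<times> (real \<times> 'a). if fst (fst p) / 2 < fst (snd p) \<and>
          fst (snd p) \<le> fst (fst p) \<and> dist (snd (fst p)) (snd (snd p)) < fst (fst p) then 1 else 0 :: ennreal)
        \<in> borel_measurable ((borel \<Otimes>\<^sub>M borel) \<Otimes>\<^sub>M (borel \<Otimes>\<^sub>M borel))"
      by measurable
    moreover have "(\<lambda>p :: (real \<times> 'a) \<times> (real \<times> 'a). if fst (fst p) / 2 < fst (snd p) \<and>
          fst (snd p) \<le> fst (fst p) \<and> dist (snd (fst p)) (snd (snd p)) < fst (fst p) then 1 else 0 :: ennreal)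
        = (\<lambda>p. indicator (whitney_box (fst (fst p)) (snd (fst p))) (snd p))"
      by (auto simp: whitney_box_def indicator_def fun_eq_iff)
    ultimately show ?thesis by (simp add: borel_prod)
  qed
  have int: "(\<lambda>z :: real \<times> 'a. \<integral>\<^sup>+w\<in>whitney_box (fst z) (snd z). F w \<partial>lborel) \<in> borel_measurable borel"
    if [measurable]: "F \<in> borel_measurable borel" for F :: "real \<times> 'a \<Rightarrow> ennreal"
    by (rule lborel.borel_measurable_nn_integral) (simp add: case_prod_beta' cong: measurable_cong_sets)
  show ?thesis
  proof (cases "r = \<infinity>")
    case True
    have "(\<lambda>z. local_mean \<infinity> g (whitney_box (fst z) (snd z))) \<in> borel_measurable borel"
    proof (rule borel_measurableI_le)
      fix l :: ennreal
      \<comment> \<open>An essential supremum is not an integral, but its sublevel sets are zero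
        sets of one: the measure of the part of the box where \<open>g\<close> exceeds l.\<close>
      have "local_mean \<infinity> g (whitney_box t x) \<le> l \<longleftrightarrow>
          (\<integral>\<^sup>+w\<in>whitney_box t x. indicator {w. l < ennreal (g w)} w \<partial>lborel) = 0" for t x
        by (subst nn_integral_0_iff_AE)
          (simp_all add: local_mean_top_le_iff[unfolded infinity_ennreal_def] indicator_def not_less
            disj_commute imp_conv_disj)
      then show "{z \<in> space borel. local_mean \<infinity> g (whitney_box (fst z) (snd z)) \<le> l} \<in> sets borel"
        using int[of "indicator {w. l < ennreal (g w)}"] by simp
    qed
    with True show ?thesis by simp
  next
    case False
    have "(\<lambda>z :: real \<times> 'a. emeasure lborel (whitney_box (fst z) (snd z))) \<in> borel_measurable borel"
      using int[of "\<lambda>_. 1"] by simp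
    then show ?thesis
      using False int[of "\<lambda>w. ennreal (g w powr enn2real r)"]
      by (simp add: local_mean_def)
  qed
qed

text \<open>The pieces are halves in height times balls of radius t/4. Such a ball around c lies in
  \<open>ball y s\<close> for all y within t/4 of c, because t/2 \<le> s, and a half interval leaves
  s a range of length t/4.\<close>

lemma local_mean_whitney_box_spread:
  assumes r: "0 < r"
  obtains \<kappa> :: real where "0 < \<kappa>" and
    "\<And>(g :: real \<times> 'a::euclidean_space \<Rightarrow> real) t x l.
      g \<in> borel_measurable borel \<Longrightarrow> 0 < t \<Longrightarrow> 0 < l \<Longrightarrow>
      ennreal l < local_mean r g (whitney_box t x) \<Longrightarrow>
      \<exists>a c. dist x c \<le> t \<and> 3 * t / 4 \<le> a \<and> a \<le> t \<and>
        (\<forall>s\<in>{a..a + t/4}. \<forall>y\<in>ball c (t/4). ennreal (\<kappa> * l) \<le> local_mean r g (whitney_box s y))"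
proof -
  \<comment> \<open>A finite 1/4-net of the unit ball. Its images x + t z give the same number of
    pieces for all t and x, which keeps \<kappa> uniform.\<close>
  obtain Z :: "'a set" where Z: "finite Z" "Z \<subseteq> cball 0 1" "cball 0 1 \<subseteq> (\<Union>z\<in>Z. ball z (1/4))"
    using seq_compact_imp_totally_bounded[OF compact_imp_seq_compact[OF compact_cball[of "0::'a" 1]],
        rule_format, of "1/4"] by auto
  define I where "I = Z \<times> (UNIV :: bool set)"
  have "Z \<noteq> {}" using Z(3) by auto
  then have I: "finite I" "I \<noteq> {}" using Z by (auto simp: I_def)
  \<comment> \<open>Heights s reach at most 5t/4, so a box at (s, y) has at most (5/4)^(d+1) times
    the measure of the box at (t, x).\<close>
  have K: "(0::real) < (5/4) ^ (DIM('a) + 1)" by simp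
  show thesis
  proof (rule local_mean_cover[OF r K I])
    fix \<kappa> :: real
    assume \<kappa>: "0 < \<kappa>" and cover:
    "\<And>(g :: real \<times> 'a \<Rightarrow> real) A B l.
      g \<in> borel_measurable borel \<Longrightarrow> A \<in> sets borel \<Longrightarrow> (\<And>i. i \<in> I \<Longrightarrow> B i \<in> sets borel) \<Longrightarrow>
      A \<subseteq> (\<Union>i\<in>I. B i) \<Longrightarrow> 0 < emeasure lborel A \<Longrightarrow> emeasure lborel A < \<infinity> \<Longrightarrow> 0 < l \<Longrightarrow>
      ennreal l < local_mean r g A \<Longrightarrow>
      \<exists>i\<in>I. \<forall>A'. A' \<in> sets borel \<longrightarrow> B i \<subseteq> A' \<longrightarrow> 0 < emeasure lborel A' \<longrightarrow>
        emeasure lborel A' \<le> ennreal ((5/4) ^ (DIM('a) + 1)) * emeasure lborel A \<longrightarrow>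
        ennreal (\<kappa> * l) \<le> local_mean r g A'"
    show thesis
    proof (rule that[OF \<kappa>])
    fix g :: "real \<times> 'a \<Rightarrow> real" and t l :: real and x :: 'a
    assume g: "g \<in> borel_measurable borel" and t: "0 < t" and l: "0 < l"
      and less: "ennreal l < local_mean r g (whitney_box t x)"
    define c where "c i = x + t *\<^sub>R fst i" for i :: "'a \<times> bool"
    define B where "B i = (if snd i then {t/2<..3*t/4} else {3*t/4<..t}) \<times> ball (c i) (t/4)" for i
    have "\<exists>i\<in>I. \<forall>A'. A' \<in> sets borel \<longrightarrow> B i \<subseteq> A' \<longrightarrow> 0 < emeasure lborel A' \<longrightarrow>
        emeasure lborel A' \<le> ennreal ((5/4) ^ (DIM('a) + 1)) * emeasure lborel (whitney_box t x) \<longrightarrow>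
        ennreal (\<kappa> * l) \<le> local_mean r g A'"
    proof (rule cover[OF g whitney_box_borel _ _ emeasure_whitney_box_pos_finite[OF t] l less])
      show "B i \<in> sets borel" for i unfolding B_def by (intro borel_Times) auto
      show "whitney_box t x \<subseteq> (\<Union>i\<in>I. B i)"
      proof clarify
        fix s y assume sy: "(s, y) \<in> whitney_box t x"
        then have "(1 / t) *\<^sub>R (y - x) \<in> cball 0 1"
          using t by (simp add: whitney_box_def dist_norm norm_minus_commute)
        then obtain z where z: "z \<in> Z" "dist z ((1 / t) *\<^sub>R (y - x)) < 1/4"
          using Z(3) unfolding ball_def by blast
        have "dist (x + t *\<^sub>R z) y = norm (t *\<^sub>R (z - (1 / t) *\<^sub>R (y - x)))"
          using t by (simp add: dist_norm algebra_simps)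
        also have "\<dots> = t * dist z ((1 / t) *\<^sub>R (y - x))"
          unfolding norm_scaleR dist_norm using t by simp
        also have "\<dots> < t / 4" using z t by simp
        finally have "(s, y) \<in> B (z, s \<le> 3*t/4)"
          using sy by (auto simp: B_def c_def whitney_box_def)
        then show "(s, y) \<in> (\<Union>i\<in>I. B i)" using z by (auto simp: I_def)
      qed
    qed
    then obtain i where i: "i \<in> I" and big:
      "\<And>A'. A' \<in> sets borel \<Longrightarrow> B i \<subseteq> A' \<Longrightarrow> 0 < emeasure lborel A' \<Longrightarrow>
        emeasure lborel A' \<le> ennreal ((5/4) ^ (DIM('a) + 1)) * emeasure lborel (whitney_box t x) \<Longrightarrow>
        ennreal (\<kappa> * l) \<le> local_mean r g A'" by blast
    \<comment> \<open>The lower half \<open>{t/2<..3*t/4}\<close> lies in \<open>{s/2<..s}\<close>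
      exactly for 3t/4 \<le> s \<le> t, the upper half exactly for t \<le> s \<le> 3t/2; of the
      latter range the part up to 5t/4 is used.\<close>
    define a where "a = (if snd i then 3*t/4 else t)"
    have a: "3 * t / 4 \<le> a" "a \<le> t" using t by (auto simp: a_def)
    have "dist x (c i) \<le> t"
      using i Z(2) t by (auto simp: I_def c_def dist_norm intro!: mult_left_le)
    moreover have "ennreal (\<kappa> * l) \<le> local_mean r g (whitney_box s y)"
      if s: "s \<in> {a..a + t/4}" and y: "y \<in> ball (c i) (t/4)" for s y
    proof (rule big)
      have s0: "0 < s" "3*t/4 \<le> s" "s \<le> 5/4 * t" using s a t by auto
      show "whitney_box s y \<in> sets borel" by simp
      show "0 < emeasure lborel (whitney_box s y)" using s0 by (simp add: emeasure_whitney_box)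
      show "B i \<subseteq> whitney_box s y"
      proof clarify
        fix s' y' assume sy': "(s', y') \<in> B i"
        have "dist y y' \<le> dist (c i) y + dist (c i) y'" by (metis dist_commute dist_triangle)
        also have "\<dots> < t/4 + t/4" using sy' y by (auto simp: B_def)
        also have "\<dots> \<le> s" using s0 t by simp
        finally show "(s', y') \<in> whitney_box s y"
          using sy' s t by (auto simp: B_def whitney_box_def a_def split: if_splits)
      qed
      have "unit_ball_vol (real DIM('a)) / 2 * s ^ (DIM('a) + 1)
          \<le> unit_ball_vol (real DIM('a)) / 2 * (5/4 * t) ^ (DIM('a) + 1)"
        using s0 by (intro mult_left_mono power_mono) auto
      then show "emeasure lborel (whitney_box s y)
          \<le> ennreal ((5/4) ^ (DIM('a) + 1)) * emeasure lborel (whitney_box t x)"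
        using s0 t unfolding emeasure_whitney_box[OF s0(1)] emeasure_whitney_box[OF t]
        by (subst ennreal_mult[symmetric])
          (auto intro!: ennreal_leI simp: power_mult_distrib power_divide algebra_simps)
    qed
    ultimately show "\<exists>a c. dist x c \<le> t \<and> 3 * t / 4 \<le> a \<and> a \<le> t \<and>
        (\<forall>s\<in>{a..a + t/4}. \<forall>y\<in>ball c (t/4). ennreal (\<kappa> * l) \<le> local_mean r g (whitney_box s y))"
      using a by blast
    qed
  qed
qed

section \<open>Borel representatives and Whitney means as means over the product\<close>

lemma borel_measurable_fst_powr: "(\<lambda>w :: real \<times> 'a::euclidean_space. fst w powr c) \<in> borel_measurable borel"
  unfolding borel_prod[symmetric] by measurable

text \<open>A Borel function on the product has Borel sections and admits Tonelli. The weight and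
  the norm are absorbed into \<open>g\<close>, so \<beta> disappears from the estimates on
  boxes.\<close>

lemma ex_borel_representative:
  fixes f :: "real \<times> 'a::euclidean_space \<Rightarrow> complex"
  assumes f: "f \<in> borel_measurable (lebesgue_on upper_half_space)"
  obtains g :: "real \<times> 'a \<Rightarrow> real" where "g \<in> borel_measurable borel" "\<And>w. 0 \<le> g w"
    "AE w in lborel. 0 < fst w \<longrightarrow> norm (of_real (fst w powr (-\<beta>)) * f w) = g w"
proof -
  have uhs: "upper_half_space = {w :: real \<times> 'a. 0 < fst w}"
    by (auto simp: upper_half_space_def)
  have [measurable]: "(upper_half_space :: (real \<times> 'a) set) \<in> sets borel"
    unfolding upper_half_space_def by (intro borel_open open_Times) auto
  have m1: "(\<lambda>w :: real \<times> 'a. fst w powr (-\<beta>)) \<in> borel_measurable (lebesgue_on upper_half_space)"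
    by (intro measurable_restrict_space1 measurable_completion) (simp add: borel_measurable_fst_powr)
  have "(\<lambda>w. norm (of_real (fst w powr (-\<beta>)) * f w)) \<in> borel_measurable (lebesgue_on upper_half_space)"
    using m1 f by measurable
  then have "(\<lambda>w. if w \<in> upper_half_space then norm (of_real (fst w powr (-\<beta>)) * f w) else 0)
      \<in> borel_measurable lebesgue"
    by (subst borel_measurable_if) auto
  from completion_ex_borel_measurable_real[OF this] obtain g where g: "g \<in> borel_measurable lborel"
    "AE w in lborel. (if w \<in> upper_half_space then norm (of_real (fst w powr (-\<beta>)) * f w) else 0) = g w"
    by blast
  show ?thesis
  \<comment> \<open>The absolute value makes the representative nonnegative everywhere, not just
    almost everywhere.\<close>
  proof (rule that[of "\<lambda>w. \<bar>g w\<bar>"])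
    show "AE w in lborel. 0 < fst w \<longrightarrow> norm (of_real (fst w powr (-\<beta>)) * f w) = \<bar>g w\<bar>"
      using g(2) by eventually_elim (auto simp: uhs split: if_splits dest!: sym[of "norm _" "g _"])
  qed (use g in auto)
qed

text \<open>The equality holds at every point with t > 0, although the functions agree only almost
  everywhere, because both sides see them through integrals and essential suprema alone.\<close>

lemma whitney_mean_eq_local_mean:
  fixes f :: "real \<times> 'a::euclidean_space \<Rightarrow> complex"
  assumes f: "f \<in> borel_measurable (lebesgue_on upper_half_space)"
    and g [measurable]: "g \<in> borel_measurable borel"
    and fg: "AE w in lborel. 0 < fst w \<longrightarrow> norm (of_real (fst w powr (-\<beta>)) * f w) = g w"
    and t: "0 < t"
  shows "whitney_mean r \<beta> f t x = local_mean r g (whitney_box t x)"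
proof (cases "r = \<infinity>")
  case True
  let ?h = "\<lambda>w. ennreal (norm (of_real (fst w powr (-\<beta>)) * f w))"
  let ?A = "whitney_box t x"
  have sub: "?A \<subseteq> upper_half_space" using t by (auto simp: whitney_box_def upper_half_space_def)
  have m1: "(\<lambda>w :: real \<times> 'a. fst w powr (-\<beta>)) \<in> borel_measurable (lebesgue_on ?A)"
    by (intro measurable_restrict_space1 measurable_completion) (simp add: borel_measurable_fst_powr)
  have "f \<in> borel_measurable (lebesgue_on ?A)"
    using f sub by (rule measurable_restrict_mono)
  then have h: "?h \<in> borel_measurable (lebesgue_on ?A)"
    using m1 by measurable
  have "?h = (\<lambda>(s, y). ennreal (norm (of_real (s powr (-\<beta>)) * f (s, y))))" by auto
  then have eq: "whitney_mean r \<beta> f t x = esssup (lebesgue_on ?A) ?h"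
    using True by (simp add: whitney_mean_def whitney_box_def)
  have AE_iff: "(AE w in lebesgue_on ?A. P w) \<longleftrightarrow> (AE w in lborel. w \<in> ?A \<longrightarrow> P w)" for P
    by (subst AE_restrict_space_iff) (auto simp: AE_completion_iff)
  \<comment> \<open>The two essential suprema belong to different measures; they are compared
    through their upper bounds, each an almost everywhere statement for
    \<open>lborel\<close>.\<close>
  have "esssup (lebesgue_on ?A) ?h \<le> z \<longleftrightarrow> local_mean r g ?A \<le> z" for z
  proof -
    have "esssup (lebesgue_on ?A) ?h \<le> z \<longleftrightarrow> (AE w in lebesgue_on ?A. ?h w \<le> z)"
    proof
      assume "esssup (lebesgue_on ?A) ?h \<le> z"
      with esssup_AE[of ?h "lebesgue_on ?A"] show "AE w in lebesgue_on ?A. ?h w \<le> z"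
        by (auto elim: eventually_mono order_trans)
    qed (use h in auto)
    also have "\<dots> \<longleftrightarrow> (AE w in lborel. w \<in> ?A \<longrightarrow> ?h w \<le> z)" by (rule AE_iff)
    also have "\<dots> \<longleftrightarrow> (AE w in lborel. w \<in> ?A \<longrightarrow> ennreal (g w) \<le> z)"
    proof -
      have "AE w in lborel. (w \<in> ?A \<longrightarrow> ?h w \<le> z) = (w \<in> ?A \<longrightarrow> ennreal (g w) \<le> z)"
        using fg by eventually_elim (use t in \<open>auto simp: whitney_box_def\<close>)
      then show ?thesis by (auto elim: eventually_elim2)
    qed
    also have "\<dots> \<longleftrightarrow> local_mean r g ?A \<le> z"
      using True local_mean_top_le_iff[OF g whitney_box_borel] by simp
    finally show ?thesis .
  qed
  then show ?thesis unfolding eq by (auto intro: order_antisym)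
next
  case False
  define b where "b = enn2real r"
  \<comment> \<open>A null set of the product has null sections at almost every height, and the
    outer mean ignores the exceptional heights.\<close>
  have AE2: "AE s in lborel. AE y in lborel. 0 < s \<longrightarrow> norm (of_real (s powr (-\<beta>)) * f (s, y)) = g (s, y)"
  proof -
    show ?thesis
      using lborel_pair.AE_pair[unfolded lborel_prod, OF fg] by simp
  qed
  let ?V = "emeasure lborel (ball x t)"
  have "(\<integral>\<^sup>+s\<in>{t/2<..t}. mean_integral (ball x t)
      (\<lambda>y. ennreal (norm (of_real (s powr (-\<beta>)) * f (s, y)) powr b)) \<partial>lborel)
    = (\<integral>\<^sup>+s. (\<integral>\<^sup>+y. ennreal (g (s, y) powr b) * indicator (whitney_box t x) (s, y) \<partial>lborel) / ?V \<partial>lborel)"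
  proof (rule nn_integral_cong_AE, use AE2 in eventually_elim)
    case (elim s)
    show ?case
    proof (cases "s \<in> {t/2<..t}")
      case True
      then have "0 < s" using t by auto
      then have "(\<integral>\<^sup>+y\<in>ball x t. ennreal (norm (of_real (s powr (-\<beta>)) * f (s, y)) powr b) \<partial>lborel)
        = (\<integral>\<^sup>+y. ennreal (g (s, y) powr b) * indicator (whitney_box t x) (s, y) \<partial>lborel)"
        by (intro nn_integral_cong_AE, use elim in eventually_elim)
          (use True in \<open>auto simp: whitney_box_def indicator_def\<close>)
      then show ?thesis using True by (simp add: mean_integral_def nn_integral_completion)
    next
      case False
      then have "indicator {t/2<..t} s = (0::ennreal)"
        "\<And>y. indicator (whitney_box t x) (s, y) = (0::ennreal)"
        by (auto simp: whitney_box_def)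
      then show ?thesis by simp
    qed
  qed
  also have "\<dots> = (\<integral>\<^sup>+s. (\<integral>\<^sup>+y. ennreal (g (s, y) powr b) * indicator (whitney_box t x) (s, y) \<partial>lborel) \<partial>lborel) / ?V"
    by (intro nn_integral_divide lborel.borel_measurable_nn_integral)
      (simp add: case_prod_beta' lborel_prod)
  also have "(\<integral>\<^sup>+s. (\<integral>\<^sup>+y. ennreal (g (s, y) powr b) * indicator (whitney_box t x) (s, y) \<partial>lborel) \<partial>lborel)
    = (\<integral>\<^sup>+w\<in>whitney_box t x. ennreal (g w powr b) \<partial>lborel)"
    using lborel.nn_integral_fst[of "\<lambda>w. ennreal (g w powr b) * indicator (whitney_box t x) w" lborel]
    unfolding lborel_prod by simp
  finally have "mean_integral {t/2<..t} (\<lambda>s. mean_integral (ball x t)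
      (\<lambda>y. ennreal (norm (of_real (s powr (-\<beta>)) * f (s, y)) powr b)))
    = (\<integral>\<^sup>+w\<in>whitney_box t x. ennreal (g w powr b) \<partial>lborel) / ?V / ennreal (t / 2)"
    using t unfolding mean_integral_def[of "{t/2<..t}"] nn_integral_completion by simp
  also have "\<dots> = (\<integral>\<^sup>+w\<in>whitney_box t x. ennreal (g w powr b) \<partial>lborel) / emeasure lborel (whitney_box t x)"
    using t by (simp add: whitney_box_def emeasure_lborel_Times divide_ennreal_def ennreal_inverse_mult
        emeasure_ball mult_ac)
  finally show ?thesis using False by (simp add: whitney_mean_def local_mean_def b_def)
qed

subsection \<open>Level sets and coverings\<close>

lemma emeasure_lborel_greaterThan: "emeasure lborel {a::real<..} = top"
proof (rule ccontr)
  assume "emeasure lborel {a<..} \<noteq> top"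
  then obtain m where m: "emeasure lborel {a<..} = ennreal m" "0 \<le> m"
    by (cases "emeasure lborel {a<..}") auto
  have "ennreal (m + 1) = emeasure lborel {a<..<a + (m + 1)}"
    using m by simp
  also have "\<dots> \<le> ennreal m"
    unfolding m(1)[symmetric] by (intro emeasure_mono) auto
  finally show False using m by (simp add: ennreal_le_iff)
qed

lemma nn_integral_if_one:
  "{x. P x} \<in> sets borel \<Longrightarrow> (\<integral>\<^sup>+x. (if P x then 1 else 0) \<partial>lborel) = emeasure lborel {x. P x}"
proof -
  assume "{x. P x} \<in> sets borel"
  moreover have "(\<lambda>x. if P x then 1 else 0 :: ennreal) = indicator {x. P x}"
    by (auto simp: indicator_def)
  ultimately show ?thesis by simp
qed

text \<open>Layer cake formula: a value u is the length of the set of levels l > 0 below it, whether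
  l < u or l \<le> u is asked. Hence strict level sets of \<open>F\<close> may be compared with
  nonstrict ones of \<open>G\<close>, and Tonelli integrates the estimate over l.\<close>

lemma nn_integral_le_of_level_sets:
  fixes F G :: "'a::euclidean_space \<Rightarrow> ennreal"
  assumes [measurable]: "F \<in> borel_measurable borel" "G \<in> borel_measurable borel"
    and level: "\<And>l::real. 0 < l \<Longrightarrow>
      emeasure lborel {x. ennreal l < F x} \<le> ennreal K * emeasure lborel {x. ennreal l \<le> G x}"
  shows "(\<integral>\<^sup>+x. F x \<partial>lborel) \<le> ennreal K * (\<integral>\<^sup>+x. G x \<partial>lborel)"
proof -
  have F: "emeasure lborel {l. 0 < l \<and> ennreal l < u} = u" for u :: ennreal
  proof (cases u)
    case (real v)
    then have "{l. 0 < l \<and> ennreal l < u} = {0<..<v}"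
      by (auto simp: ennreal_less_iff)
    then show ?thesis using real by simp
  next
    case top
    then show ?thesis by (simp add: emeasure_lborel_greaterThan flip: greaterThan_def)
  qed
  have G: "emeasure lborel {l. 0 < l \<and> ennreal l \<le> u} = u" for u :: ennreal
  proof (cases u)
    case (real v)
    then have "{l. 0 < l \<and> ennreal l \<le> u} = {0<..v}"
      by (auto simp: ennreal_le_iff)
    then show ?thesis using real by simp
  next
    case top
    then show ?thesis by (simp add: emeasure_lborel_greaterThan flip: greaterThan_def)
  qed
  have "(\<integral>\<^sup>+x. F x \<partial>lborel)
      = (\<integral>\<^sup>+x. \<integral>\<^sup>+l. (if 0 < l \<and> ennreal l < F x then 1 else 0) \<partial>lborel \<partial>lborel)"
    using F by (simp add: nn_integral_if_one)
  also have "\<dots> = (\<integral>\<^sup>+l. \<integral>\<^sup>+x. (if 0 < l \<and> ennreal l < F x then 1 else 0) \<partial>lborel \<partial>lborel)"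
    by (rule lborel_pair.Fubini'[symmetric]) measurable
  also have "\<dots> \<le> (\<integral>\<^sup>+l. ennreal K * (\<integral>\<^sup>+x. (if 0 < l \<and> ennreal l \<le> G x then 1 else 0) \<partial>lborel) \<partial>lborel)"
  proof (rule nn_integral_mono)
    fix l :: real
    show "(\<integral>\<^sup>+x. (if 0 < l \<and> ennreal l < F x then 1 else 0) \<partial>lborel)
        \<le> ennreal K * (\<integral>\<^sup>+x. (if 0 < l \<and> ennreal l \<le> G x then 1 else 0) \<partial>lborel)"
      using level[of l] by (cases "0 < l") (simp_all add: nn_integral_if_one)
  qed
  also have "\<dots> = ennreal K * (\<integral>\<^sup>+l. \<integral>\<^sup>+x. (if 0 < l \<and> ennreal l \<le> G x then 1 else 0) \<partial>lborel \<partial>lborel)"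
    by (rule nn_integral_cmult) measurable
  also have "(\<integral>\<^sup>+l. \<integral>\<^sup>+x. (if 0 < l \<and> ennreal l \<le> G x then 1 else 0) \<partial>lborel \<partial>lborel)
      = (\<integral>\<^sup>+x. \<integral>\<^sup>+l. (if 0 < l \<and> ennreal l \<le> G x then 1 else 0) \<partial>lborel \<partial>lborel)"
    by (rule lborel_pair.Fubini') measurable
  also have "\<dots> = (\<integral>\<^sup>+x. G x \<partial>lborel)"
    using G by (simp add: nn_integral_if_one)
  finally show ?thesis .
qed

text \<open>Countable subadditivity for an index set of any type, the form that fits the subfamily
  selected by Vitali's lemma.\<close>

lemma emeasure_UN_countable_le:
  assumes B: "\<And>i. i \<in> I \<Longrightarrow> B i \<in> sets M" and I: "countable I"
  shows "emeasure M (\<Union>i\<in>I. B i) \<le> (\<integral>\<^sup>+i. emeasure M (B i) \<partial>count_space I)"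
proof -
  have "emeasure M (\<Union>i\<in>I. B i) = (\<integral>\<^sup>+x. indicator (\<Union>i\<in>I. B i) x \<partial>M)"
    using B I by (intro nn_integral_indicator[symmetric] sets.countable_UN') auto
  also have "\<dots> \<le> (\<integral>\<^sup>+x. \<integral>\<^sup>+i. indicator (B i) x \<partial>count_space I \<partial>M)"
  proof (rule nn_integral_mono)
    fix x
    show "indicator (\<Union>i\<in>I. B i) x \<le> (\<integral>\<^sup>+i. indicator (B i) x \<partial>count_space I)"
    proof (cases "x \<in> (\<Union>i\<in>I. B i)")
      case True
      then obtain i where "i \<in> I" "x \<in> B i" by blast
      then show ?thesis
        using True nn_integral_ge_point[of i I "\<lambda>i. indicator (B i) x"] by simp
    qed simp
  qed
  also have "\<dots> = (\<integral>\<^sup>+i. \<integral>\<^sup>+x. indicator (B i) x \<partial>M \<partial>count_space I)"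
    using B I by (intro nn_integral_count_space_nn_integral) auto
  also have "\<dots> = (\<integral>\<^sup>+i. emeasure M (B i) \<partial>count_space I)"
    using B by (intro nn_integral_cong) simp
  finally show ?thesis .
qed

text \<open>The balls on the left overlap without control and need not lie in \<open>E\<close>, but
  each is close to a ball in \<open>E\<close> of comparable size. Vitali's lemma is applied to
  \<open>cball (a i) (2 * t i)\<close>, which contains both: a disjoint subfamily has disjoint small
  balls in \<open>E\<close>, and its fivefold enlargements have radius 10 t = 40 (t/4), whence
  40^d.\<close>

lemma emeasure_Union_balls_le:
  fixes a c :: "'i \<Rightarrow> 'a::euclidean_space" and E :: "'a set"
  assumes [measurable]: "E \<in> sets borel"
    and t: "\<And>i. i \<in> J \<Longrightarrow> 0 < t i"
    and sub: "\<And>i. i \<in> J \<Longrightarrow> ball (c i) (t i / 4) \<subseteq> E"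
    and near: "\<And>i. i \<in> J \<Longrightarrow> dist (a i) (c i) \<le> t i"
  shows "emeasure lborel (\<Union>i\<in>J. ball (a i) (t i)) \<le> ennreal (40 ^ DIM('a)) * emeasure lborel E"
proof (cases "emeasure lborel E = \<infinity>")
  case True
  then show ?thesis by (simp add: ennreal_mult_top)
next
  case False
  define m where "m = measure lborel E"
  have m: "emeasure lborel E = ennreal m" "0 \<le> m"
    using False by (auto simp: m_def emeasure_eq_ennreal_measure)
  define v where "v = unit_ball_vol (real DIM('a))"
  have v: "0 < v" by (simp add: v_def)
  \<comment> \<open>Vitali's lemma needs bounded radii. The small ball lies in \<open>E\<close>, so
    v (t/4)^d \<le> m, and for t/4 > 1 the power dominates t/4 itself.\<close>
  have bound: "t i \<le> 4 * max 1 (m / v)" if i: "i \<in> J" for i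
  proof (cases "t i / 4 \<le> 1")
    case True
    then show ?thesis by simp
  next
    case False
    have "ennreal (v * (t i / 4) ^ DIM('a)) = emeasure lborel (ball (c i) (t i / 4))"
      using t[OF i] by (simp add: emeasure_ball v_def)
    also have "\<dots> \<le> ennreal m"
      using sub[OF i] unfolding m(1)[symmetric] by (intro emeasure_mono) auto
    finally have "v * (t i / 4) ^ DIM('a) \<le> m" using m by (simp add: ennreal_le_iff)
    moreover have "t i / 4 \<le> (t i / 4) ^ DIM('a)"
      using False DIM_positive[where 'a='a] by (intro self_le_power) auto
    ultimately have "v * (t i / 4) \<le> m"
      using v by (meson mult_left_mono order_trans less_imp_le)
    then have "t i / 4 \<le> m / v" using v by (simp add: field_simps)
    also have "\<dots> \<le> max 1 (m / v)" by simp
    finally show ?thesis by linarith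
  qed
  obtain C where C: "countable C" "C \<subseteq> J"
    "pairwise (\<lambda>i j. disjnt (cball (a i) (2 * t i)) (cball (a j) (2 * t j))) C"
    "(\<Union>i\<in>J. ball (a i) (t i)) \<subseteq> (\<Union>i\<in>C. cball (a i) (5 * (2 * t i)))"
  proof (rule Vitali_covering_lemma_cballs)
    show "(\<Union>i\<in>J. ball (a i) (t i)) \<subseteq> (\<Union>i\<in>J. cball (a i) (2 * t i))"
      using t by fastforce
    show "0 < 2 * t i \<and> 2 * t i \<le> 2 * (4 * max 1 (m / v))" if "i \<in> J" for i
      using t[OF that] bound[OF that] by simp
  qed
  have small: "ball (c i) (t i / 4) \<subseteq> cball (a i) (2 * t i)" if "i \<in> J" for i
  proof
    fix y assume "y \<in> ball (c i) (t i / 4)"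
    then show "y \<in> cball (a i) (2 * t i)"
      using near[OF that] t[OF that] dist_triangle[of "a i" y "c i"] by simp
  qed
  have disj: "disjoint_family_on (\<lambda>i. ball (c i) (t i / 4)) C"
    unfolding disjoint_family_on_def
  proof (intro ballI impI)
    fix i j assume ij: "i \<in> C" "j \<in> C" "i \<noteq> j"
    then have "disjnt (cball (a i) (2 * t i)) (cball (a j) (2 * t j))"
      using C(3) by (simp add: pairwise_def)
    then show "ball (c i) (t i / 4) \<inter> ball (c j) (t j / 4) = {}"
      using small[of i] small[of j] ij C(2) unfolding disjnt_def by blast
  qed
  have "emeasure lborel (\<Union>i\<in>J. ball (a i) (t i)) \<le> emeasure lborel (\<Union>i\<in>C. cball (a i) (5 * (2 * t i)))"
    using C by (intro emeasure_mono) auto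
  also have "\<dots> \<le> (\<integral>\<^sup>+i. emeasure lborel (cball (a i) (5 * (2 * t i))) \<partial>count_space C)"
    using C(1) by (intro emeasure_UN_countable_le) auto
  also have "\<dots> = (\<integral>\<^sup>+i. ennreal (40 ^ DIM('a)) * emeasure lborel (ball (c i) (t i / 4)) \<partial>count_space C)"
  proof (intro nn_integral_cong)
    fix i assume "i \<in> space (count_space C)"
    then have "0 < t i" using C(2) t by auto
    moreover have "(5 * (2 * t i)) ^ DIM('a) = 40 ^ DIM('a) * (t i / 4) ^ DIM('a)"
      unfolding power_mult_distrib[symmetric] by simp
    ultimately have "emeasure lborel (cball (a i) (5 * (2 * t i)))
        = ennreal (40 ^ DIM('a) * (v * (t i / 4) ^ DIM('a)))"
      by (simp only: emeasure_cball v_def) (simp only: mult_ac)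
    also have "\<dots> = ennreal (40 ^ DIM('a)) * emeasure lborel (ball (c i) (t i / 4))"
      using \<open>0 < t i\<close> v by (subst ennreal_mult) (auto simp: emeasure_ball v_def)
    finally show "emeasure lborel (cball (a i) (5 * (2 * t i)))
        = ennreal (40 ^ DIM('a)) * emeasure lborel (ball (c i) (t i / 4))" .
  qed
  also have "\<dots> = ennreal (40 ^ DIM('a)) * (\<integral>\<^sup>+i. emeasure lborel (ball (c i) (t i / 4)) \<partial>count_space C)"
    by (rule nn_integral_cmult) simp
  also have "(\<integral>\<^sup>+i. emeasure lborel (ball (c i) (t i / 4)) \<partial>count_space C)
      = emeasure lborel (\<Union>i\<in>C. ball (c i) (t i / 4))"
    using C(1) disj by (intro emeasure_UN_countable[symmetric]) auto
  also have "\<dots> \<le> emeasure lborel E"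
    using sub C(2) by (intro emeasure_mono) auto
  finally show ?thesis by (simp add: mult_left_mono)
qed

subsection \<open>Interpolation\<close>

text \<open>The integral is a supremum over simple functions below the integrand, and these can be
  divided by c. This gives homogeneity for all \<open>u\<close>, measurable or not, as the abstract
  functional in the interpolation requires.\<close>

lemma nn_integral_cmult_le:
  assumes "0 < c"
  shows "(\<integral>\<^sup>+x. ennreal c * u x \<partial>M) \<le> ennreal c * (\<integral>\<^sup>+x. u x \<partial>M)"
  unfolding nn_integral_def[of M "\<lambda>x. ennreal c * u x"]
proof (rule SUP_least, clarify)
  fix s assume s: "simple_function M s" "s \<le> (\<lambda>x. ennreal c * u x)"
  have cancel: "ennreal (1 / c) * (ennreal c * v) = v" "ennreal c * (ennreal (1 / c) * v) = v" for v
    using assms by (simp_all add: ennreal_mult[symmetric] mult.assoc[symmetric])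
  have [measurable]: "s \<in> borel_measurable M"
    using s(1) by (rule borel_measurable_simple_function)
  have "integral\<^sup>S M s = (\<integral>\<^sup>+x. s x \<partial>M)"
    using s(1) by (rule nn_integral_eq_simple_integral[symmetric])
  also have "\<dots> = (\<integral>\<^sup>+x. ennreal c * (ennreal (1 / c) * s x) \<partial>M)"
    by (simp add: cancel)
  also have "\<dots> = ennreal c * (\<integral>\<^sup>+x. ennreal (1 / c) * s x \<partial>M)"
    by (rule nn_integral_cmult) measurable
  also have "\<dots> \<le> ennreal c * (\<integral>\<^sup>+x. u x \<partial>M)"
  proof (intro mult_left_mono nn_integral_mono)
    fix x
    have "ennreal (1 / c) * s x \<le> ennreal (1 / c) * (ennreal c * u x)"
      using s(2) by (intro mult_left_mono) (auto simp: le_fun_def)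
    then show "ennreal (1 / c) * s x \<le> u x" by (simp add: cancel)
  qed simp
  finally show "integral\<^sup>S M s \<le> ennreal c * (\<integral>\<^sup>+x. u x \<partial>M)" .
qed

lemma set_nn_integral_mono:
  fixes u v :: "'a \<Rightarrow> ennreal"
  shows "(\<And>x. x \<in> A \<Longrightarrow> u x \<le> v x) \<Longrightarrow> (\<integral>\<^sup>+x\<in>A. u x \<partial>M) \<le> (\<integral>\<^sup>+x\<in>A. v x \<partial>M)"
  by (intro nn_integral_mono) (simp add: indicator_def)

lemma mean_integral_lborel:
  "A \<in> sets borel \<Longrightarrow> mean_integral A h = (\<integral>\<^sup>+x\<in>A. h x \<partial>lborel) / emeasure lborel A"
  by (simp add: mean_integral_def nn_integral_completion)

lemma mean_integral_mono:
  "(\<And>x. x \<in> A \<Longrightarrow> u x \<le> v x) \<Longrightarrow> mean_integral A u \<le> mean_integral A v"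
  unfolding mean_integral_def
  by (intro divide_right_mono_ennreal set_nn_integral_mono)

lemma mean_integral_cmult_le:
  assumes "0 < c"
  shows "mean_integral A (\<lambda>x. ennreal c * u x) \<le> ennreal c * mean_integral A u"
  using divide_right_mono_ennreal[OF nn_integral_cmult_le[OF assms, of lebesgue "\<lambda>x. u x * indicator A x"],
      of "emeasure lebesgue A"]
  unfolding mean_integral_def by (simp add: ennreal_times_divide mult.assoc)

text \<open>Interpolation: \<open>w powr b \<le> m powr (b - a) * w powr a\<close> pointwise, because \<open>w \<le> m\<close>.\<close>
lemma functional_powr_bound:
  fixes \<Phi> :: "('z \<Rightarrow> ennreal) \<Rightarrow> ennreal"
  assumes mono: "\<And>u v. (\<And>z. z \<in> S \<Longrightarrow> u z \<le> v z) \<Longrightarrow> \<Phi> u \<le> \<Phi> v"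
    and hom: "\<And>c u. 0 < c \<Longrightarrow> \<Phi> (\<lambda>z. ennreal c * u z) \<le> ennreal c * \<Phi> u"
    and a: "0 < a" "a \<le> b"
    and sup: "\<And>z. z \<in> S \<Longrightarrow> w z \<le> m"
    and bound: "ennreal_powr (\<Phi> (\<lambda>z. ennreal_powr (w z) a)) (1 / a) \<le> m"
  shows "ennreal_powr (\<Phi> (\<lambda>z. ennreal_powr (w z) b)) (1 / b) \<le> m"
\<comment> \<open>m may be 0 or \<infinity>; a value strictly above it is \<infinity> or a positive
  real n, whose powers can be split.\<close>
proof (rule dense_ge)
  fix y assume y: "m < y"
  show "ennreal_powr (\<Phi> (\<lambda>z. ennreal_powr (w z) b)) (1 / b) \<le> y"
  proof (cases y)
    case (real n)
    then have n: "0 < n" using y by (cases "n = 0") auto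
    have "ennreal_powr (w z) b \<le> ennreal (n powr (b - a)) * ennreal_powr (w z) a" if z: "z \<in> S" for z
    proof -
      obtain v where v: "w z = ennreal v" "0 \<le> v" "v \<le> n"
        using le_less_trans[OF sup[OF z] y] real by (cases "w z") (auto simp: ennreal_less_iff)
      have "v powr b = v powr (b - a) * v powr a" by (simp add: powr_add[symmetric])
      also have "\<dots> \<le> n powr (b - a) * v powr a"
        using v a by (intro mult_right_mono powr_mono2) auto
      finally show ?thesis using v by (simp add: ennreal_mult[symmetric] ennreal_leI)
    qed
    then have "\<Phi> (\<lambda>z. ennreal_powr (w z) b) \<le> \<Phi> (\<lambda>z. ennreal (n powr (b - a)) * ennreal_powr (w z) a)"
      by (rule mono)
    also have "\<dots> \<le> ennreal (n powr (b - a)) * \<Phi> (\<lambda>z. ennreal_powr (w z) a)"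
      using n by (intro hom) simp
    also have "\<dots> \<le> ennreal (n powr (b - a)) * ennreal_powr (ennreal n) a"
    proof (intro mult_left_mono)
      have "ennreal_powr (\<Phi> (\<lambda>z. ennreal_powr (w z) a)) (1 / a) \<le> ennreal n"
        using bound y real by simp
      then show "\<Phi> (\<lambda>z. ennreal_powr (w z) a) \<le> ennreal_powr (ennreal n) a"
        by (simp only: ennreal_powr_le_iff[OF a(1)])
    qed simp
    also have "\<dots> = ennreal_powr (ennreal n) b"
      using n by (simp add: ennreal_mult[symmetric] powr_add[symmetric])
    finally show ?thesis
      using a real by (subst ennreal_powr_le_iff) auto
  qed simp
qed

subsection \<open>Maximal bounds\<close>

text \<open>\<open>W\<close> abstracts the Whitney means. The height \<open>a\<close> is \<open>3t/4\<close> or \<open>t\<close>, according to whether the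
  lower or the upper half of the box at \<open>(t, x)\<close> carries the mass.\<close>
definition spreading :: "real \<Rightarrow> (real \<Rightarrow> 'a::euclidean_space \<Rightarrow> ennreal) \<Rightarrow> bool" where
  "spreading \<kappa> W \<longleftrightarrow> (\<forall>t x l. 0 < t \<longrightarrow> 0 < l \<longrightarrow> ennreal l < W t x \<longrightarrow>
    (\<exists>a c. dist x c \<le> t \<and> 3 * t / 4 \<le> a \<and> a \<le> t \<and>
      (\<forall>s\<in>{a..a + t/4}. \<forall>y\<in>ball c (t/4). ennreal (\<kappa> * l) \<le> W s y)))"

lemma spreadingE:
  assumes "spreading \<kappa> W" "0 < t" "0 < l" "ennreal l < W t x"
  obtains a c where "dist x c \<le> t" "3 * t / 4 \<le> a" "a \<le> t"
    "\<And>s y. s \<in> {a..a + t/4} \<Longrightarrow> y \<in> ball c (t/4) \<Longrightarrow> ennreal (\<kappa> * l) \<le> W s y"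
proof -
  obtain a c where "dist x c \<le> t \<and> 3 * t / 4 \<le> a \<and> a \<le> t \<and>
      (\<forall>s\<in>{a..a + t/4}. \<forall>y\<in>ball c (t/4). ennreal (\<kappa> * l) \<le> W s y)"
    using assms(1)[unfolded spreading_def, rule_format, OF assms(2-4)] by (elim exE)
  then show ?thesis by (intro that[of c a]) auto
qed

text \<open>1/5 is the length t/4 times the least weight 4/(5t), attained at the greatest possible
  height 5t/4. It is free of t because dt/t is invariant under scaling.\<close>

lemma nn_integral_dt_over_t_ge:
  assumes "0 < t" "3 * t / 4 \<le> a" "a \<le> t" and "{a..a + t/4} \<subseteq> S"
    and ge: "\<And>s. s \<in> {a..a + t/4} \<Longrightarrow> k \<le> F s"
  shows "k * ennreal (1/5) \<le> (\<integral>\<^sup>+s\<in>S. F s * ennreal (1 / s) \<partial>lborel)"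
proof -
  have "k * ennreal (1/5) = k * ennreal (4 / (5 * t)) * ennreal (t / 4)"
    using assms by (simp add: mult.assoc ennreal_mult[symmetric])
  also have "\<dots> = (\<integral>\<^sup>+s. k * ennreal (4 / (5 * t)) * indicator {a..a + t/4} s \<partial>lborel)"
    using assms by (simp add: nn_integral_cmult_indicator)
  also have "\<dots> \<le> (\<integral>\<^sup>+s\<in>S. F s * ennreal (1 / s) \<partial>lborel)"
  proof (rule nn_integral_mono)
    fix s
    show "k * ennreal (4 / (5 * t)) * indicator {a..a + t/4} s \<le> F s * ennreal (1 / s) * indicator S s"
    proof (cases "s \<in> {a..a + t/4}")
      case True
      then have "0 < s" "s \<le> 5 * t / 4" using assms by auto
      then have "4 / (5 * t) \<le> 1 / s" using assms by (simp add: field_simps)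
      then have "k * ennreal (4 / (5 * t)) \<le> F s * ennreal (1 / s)"
        using ge[OF True] by (intro mult_mono ennreal_leI) auto
      then show ?thesis using True assms by auto
    qed simp
  qed
  finally show ?thesis .
qed

text \<open>The Carleson box is centred at c rather than x, so the position of the ball of large
  means is harmless. Radius 2t covers the heights up to 5t/4, and \<open>ball c (t/4)\<close> fills
  the fraction 8^(-d) of \<open>ball c (2 * t)\<close>; the height integral contributes the
  5.\<close>

lemma spreading_le_carleson:
  fixes W :: "real \<Rightarrow> 'a::euclidean_space \<Rightarrow> ennreal"
  assumes W: "spreading \<kappa> W" and \<kappa>: "0 < \<kappa>" and q: "0 < q"
    and N: "\<And>\<tau> y. 0 < \<tau> \<Longrightarrow> ennreal_powr (\<integral>\<^sup>+t\<in>{0<..<\<tau>}. mean_integral (ball y \<tau>)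
        (\<lambda>x. ennreal_powr (W t x) q) * ennreal (1 / t) \<partial>lborel) (1 / q) \<le> N"
    and t: "0 < t"
  shows "W t x \<le> ennreal ((5 * 8 ^ DIM('a)) powr (1 / q) / \<kappa>) * N"
proof (rule dense_le)
  fix u assume u: "u < W t x"
  then obtain l where l: "u = ennreal l" "0 \<le> l" by (cases u) auto
  show "u \<le> ennreal ((5 * 8 ^ DIM('a)) powr (1 / q) / \<kappa>) * N"
  proof (cases "l = 0")
    case True
    then show ?thesis using l by simp
  next
    case False
    with l u have "0 < l" "ennreal l < W t x" by auto
    from spreadingE[OF W t this] obtain a c where ac: "dist x c \<le> t" "3 * t / 4 \<le> a" "a \<le> t"
      and ge: "\<And>s y. s \<in> {a..a + t/4} \<Longrightarrow> y \<in> ball c (t/4) \<Longrightarrow> ennreal (\<kappa> * l) \<le> W s y" by metis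
    let ?k = "ennreal ((\<kappa> * l) powr q)"
    define v where "v = unit_ball_vol (real DIM('a))"
    have v: "0 < v" by (simp add: v_def)
    have "ennreal ((\<kappa> * l) powr q / 8 ^ DIM('a)) \<le> mean_integral (ball c (2 * t)) (\<lambda>x. ennreal_powr (W s x) q)"
      if s: "s \<in> {a..a + t/4}" for s
    proof -
      have "(t / 4) ^ DIM('a) * 8 ^ DIM('a) = (2 * t) ^ DIM('a)"
        unfolding power_mult_distrib[symmetric] by simp
      then have "(\<kappa> * l) powr q / 8 ^ DIM('a)
          = (\<kappa> * l) powr q * (v * (t / 4) ^ DIM('a)) / (v * (2 * t) ^ DIM('a))"
        using v t by (simp add: field_simps)
      then have "ennreal ((\<kappa> * l) powr q / 8 ^ DIM('a))
          = ?k * emeasure lborel (ball c (t/4)) / emeasure lborel (ball c (2 * t))"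
        using v t by (simp add: emeasure_ball v_def[symmetric] ennreal_mult[symmetric] divide_ennreal)
      also have "?k * emeasure lborel (ball c (t/4)) = (\<integral>\<^sup>+y. ?k * indicator (ball c (t/4)) y \<partial>lborel)"
        by (simp add: nn_integral_cmult_indicator)
      also have "\<dots> / emeasure lborel (ball c (2 * t))
          \<le> (\<integral>\<^sup>+y\<in>ball c (2 * t). ennreal_powr (W s y) q \<partial>lborel) / emeasure lborel (ball c (2 * t))"
      proof (intro divide_right_mono_ennreal nn_integral_mono)
        fix y
        show "?k * indicator (ball c (t/4)) y \<le> ennreal_powr (W s y) q * indicator (ball c (2 * t)) y"
        proof (cases "y \<in> ball c (t/4)")
          case True
          have "?k = ennreal_powr (ennreal (\<kappa> * l)) q" using \<kappa> l by simp
          also have "\<dots> \<le> ennreal_powr (W s y) q"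
            using ge[OF s True] q by (intro ennreal_powr_mono) auto
          finally show ?thesis using True t by simp
        qed simp
      qed
      finally show ?thesis by (simp add: mean_integral_lborel)
    qed
    then have "ennreal ((\<kappa> * l) powr q / 8 ^ DIM('a)) * ennreal (1/5)
        \<le> (\<integral>\<^sup>+s\<in>{0<..<2 * t}. mean_integral (ball c (2 * t)) (\<lambda>x. ennreal_powr (W s x) q) * ennreal (1 / s) \<partial>lborel)"
      using ac t by (intro nn_integral_dt_over_t_ge[OF t ac(2,3)]) auto
    also have "\<dots> \<le> ennreal_powr N q"
      using N[of "2 * t" c] t q by (simp add: ennreal_powr_le_iff)
    finally have "ennreal ((\<kappa> * l) powr q / (5 * 8 ^ DIM('a))) \<le> ennreal_powr N q"
      by (simp add: ennreal_mult[symmetric] mult.commute)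
    then have "ennreal_powr (ennreal ((\<kappa> * l) powr q / (5 * 8 ^ DIM('a)))) (1 / q) \<le> N"
      using q by (subst ennreal_powr_le_iff) auto
    then have "ennreal ((\<kappa> * l) / (5 * 8 ^ DIM('a)) powr (1 / q)) \<le> N"
      using \<kappa> l q by (simp add: powr_divide powr_powr)
    then have "ennreal ((5 * 8 ^ DIM('a)) powr (1 / q) / \<kappa>) * ennreal ((\<kappa> * l) / (5 * 8 ^ DIM('a)) powr (1 / q))
        \<le> ennreal ((5 * 8 ^ DIM('a)) powr (1 / q) / \<kappa>) * N"
      by (rule mult_left_mono) simp
    then show ?thesis using \<kappa> l by (simp add: ennreal_mult[symmetric])
  qed
qed

text \<open>Between the nontangential maximal function \<open>H\<close> and the vertical functional
  \<open>V\<close> stands \<open>h\<close>, the supremum of the levels held throughout a cylinder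
  whose base contains x. The vertical line over x crosses such a cylinder, so \<open>h\<close> is
  bounded by \<open>V\<close> pointwise, whereas \<open>H\<close> and \<open>h\<close> are compared
  only through the measures of their level sets.\<close>

lemma spreading_nontangential_bound:
  fixes W :: "real \<Rightarrow> 'a::euclidean_space \<Rightarrow> ennreal"
  assumes W: "spreading \<kappa> W" and \<kappa>: "0 < \<kappa>" and q: "0 < q" and p: "0 < p"
  obtains H where "H \<in> borel_measurable borel" "\<And>t x. 0 < t \<Longrightarrow> W t x \<le> H x"
    "(\<integral>\<^sup>+x. ennreal_powr (H x) p \<partial>lborel) \<le> ennreal (40 ^ DIM('a) * (5 powr (1 / q) / \<kappa>) powr p) *
      (\<integral>\<^sup>+x. ennreal_powr (ennreal_powr (\<integral>\<^sup>+t\<in>{0<..}. ennreal_powr (W t x) q * ennreal (1 / t) \<partial>lborel)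
        (1 / q)) p \<partial>lborel)"
proof
  define V where "V x = ennreal_powr (\<integral>\<^sup>+t\<in>{0<..}. ennreal_powr (W t x) q * ennreal (1 / t) \<partial>lborel) (1 / q)" for x
  \<comment> \<open>\<open>H\<close> and \<open>h\<close> are lower semicontinuous, hence measurable without any assumption on \<open>W\<close>.\<close>
  define H where "H x = (SUP (t, y)\<in>{(t, y). 0 < t \<and> x \<in> ball y t}. W t y)" for x
  define S where "S = {(l, t, c). 0 < t \<and> 0 < l \<and> (\<exists>a. 3 * t / 4 \<le> a \<and> a \<le> t \<and>
      (\<forall>s\<in>{a..a + t/4}. \<forall>y\<in>ball c (t/4). ennreal l \<le> W s y))}"
  define h where "h x = (SUP (l, t, c)\<in>{(l, t, c). (l, t, c) \<in> S \<and> x \<in> ball c (t/4)}. ennreal l)" for x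
  show W_le: "W t x \<le> H x" if "0 < t" for t x
    unfolding H_def using that by (intro SUP_upper2[where i = "(t, x)"]) auto
  have H_level: "{x. l < H x} = (\<Union>(t, y)\<in>{(t, y). 0 < t \<and> l < W t y}. ball y t)" for l
    by (fastforce simp: H_def less_SUP_iff)
  show H [measurable]: "H \<in> borel_measurable borel"
    by (rule borel_measurableI_greater) (auto simp: H_level intro!: borel_open open_UN)
  have h_level: "{x. l < h x} = (\<Union>(l', t, c)\<in>{(l', t, c). (l', t, c) \<in> S \<and> l < ennreal l'}. ball c (t/4))" for l
    by (fastforce simp: h_def less_SUP_iff)
  have h [measurable]: "h \<in> borel_measurable borel"
    by (rule borel_measurableI_greater) (auto simp: h_level intro!: borel_open open_UN)
  have h_le: "h x \<le> ennreal (5 powr (1 / q)) * V x" for x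
    unfolding h_def
  proof (rule SUP_least, clarify)
    fix l t c assume S: "(l, t, c) \<in> S" and x: "x \<in> ball c (t/4)"
    then obtain a where a: "0 < t" "0 < l" "3 * t / 4 \<le> a" "a \<le> t"
      and ge: "\<And>s. s \<in> {a..a + t/4} \<Longrightarrow> ennreal l \<le> W s x" by (auto simp: S_def)
    have "ennreal (l powr q) * ennreal (1/5) \<le> (\<integral>\<^sup>+t\<in>{0<..}. ennreal_powr (W t x) q * ennreal (1 / t) \<partial>lborel)"
    proof (rule nn_integral_dt_over_t_ge[OF a(1,3,4)])
      show "{a..a + t/4} \<subseteq> {0<..}" using a by auto
      fix s assume "s \<in> {a..a + t/4}"
      from ennreal_powr_mono[OF _ ge[OF this], of q] show "ennreal (l powr q) \<le> ennreal_powr (W s x) q"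
        using a q by simp
    qed
    then have "ennreal_powr (ennreal (l powr q / 5)) (1 / q) \<le> V x"
      unfolding V_def using q by (intro ennreal_powr_mono) (simp_all add: ennreal_mult[symmetric])
    then have "ennreal (l / 5 powr (1 / q)) \<le> V x"
      using a q by (simp add: powr_divide powr_powr)
    then have "ennreal (5 powr (1 / q)) * ennreal (l / 5 powr (1 / q)) \<le> ennreal (5 powr (1 / q)) * V x"
      by (rule mult_left_mono) simp
    then show "ennreal l \<le> ennreal (5 powr (1 / q)) * V x"
      using a by (simp add: ennreal_mult[symmetric])
  qed
  \<comment> \<open>The set on the left is a union of balls, and spreading puts near each of them a
    ball of a quarter of its radius on which \<open>h\<close> is at least \<kappa> l: the setting of
    the covering estimate.\<close>
  have level: "emeasure lborel {x. ennreal l < H x}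
      \<le> ennreal (40 ^ DIM('a)) * emeasure lborel {x. ennreal (\<kappa> * l) \<le> h x}" if l: "0 < l" for l :: real
  proof -
    define J where "J = {(t, y). 0 < t \<and> ennreal l < W t y}"
    have "\<exists>c. dist (snd i) c \<le> fst i \<and> (\<kappa> * l, fst i, c) \<in> S" if "i \<in> J" for i
    proof -
      have i: "0 < fst i" "ennreal l < W (fst i) (snd i)" using that by (auto simp: J_def)
      obtain a c where near: "dist (snd i) c \<le> fst i" and "3 * fst i / 4 \<le> a" "a \<le> fst i"
        "\<And>s y. s \<in> {a..a + fst i/4} \<Longrightarrow> y \<in> ball c (fst i/4) \<Longrightarrow> ennreal (\<kappa> * l) \<le> W s y"
        by (rule spreadingE[OF W i(1) l i(2)]) (rule that)
      then have "(\<kappa> * l, fst i, c) \<in> S"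
        using i(1) \<kappa> l unfolding S_def by (auto intro!: exI[of _ a])
      with near show ?thesis by blast
    qed
    then obtain c where c: "\<And>i. i \<in> J \<Longrightarrow> dist (snd i) (c i) \<le> fst i" "\<And>i. i \<in> J \<Longrightarrow> (\<kappa> * l, fst i, c i) \<in> S"
      by metis
    have "emeasure lborel (\<Union>i\<in>J. ball (snd i) (fst i))
        \<le> ennreal (40 ^ DIM('a)) * emeasure lborel {x. ennreal (\<kappa> * l) \<le> h x}"
    proof (rule emeasure_Union_balls_le[where c = c])
      fix i assume i: "i \<in> J"
      show "ball (c i) (fst i / 4) \<subseteq> {x. ennreal (\<kappa> * l) \<le> h x}"
        using c(2)[OF i] unfolding h_def by (auto intro!: SUP_upper2[where i = "(\<kappa> * l, fst i, c i)"])
    qed (use c in \<open>auto simp: J_def\<close>)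
    also have "(\<Union>i\<in>J. ball (snd i) (fst i)) = {x. ennreal l < H x}"
      unfolding H_level J_def by auto
    finally show ?thesis .
  qed
  have "(\<integral>\<^sup>+x. ennreal_powr (H x) p \<partial>lborel)
      \<le> ennreal (40 ^ DIM('a)) * (\<integral>\<^sup>+x. ennreal_powr (ennreal (1 / \<kappa>) * h x) p \<partial>lborel)"
  proof (rule nn_integral_le_of_level_sets)
    fix m :: real assume m: "0 < m"
    \<comment> \<open>Level m of the p-th power of \<open>H\<close> is level l of \<open>H\<close>.
      Scaling \<open>h\<close> by 1/\<kappa> undoes the loss in the level, so both sides are read
      off at the same m.\<close>
    define l where "l = m powr (1 / p)"
    have l: "0 < l" "ennreal_powr (ennreal m) (1 / p) = ennreal l" using m by (auto simp: l_def)
    have "{x. ennreal m < ennreal_powr (H x) p} = {x. ennreal l < H x}"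
      using le_ennreal_powr_iff[OF p, of _ "ennreal m"] l(2) by (auto simp: not_le[symmetric])
    then have "emeasure lborel {x. ennreal m < ennreal_powr (H x) p}
        \<le> ennreal (40 ^ DIM('a)) * emeasure lborel {x. ennreal (\<kappa> * l) \<le> h x}"
      using level[OF l(1)] by simp
    also have "\<dots> \<le> ennreal (40 ^ DIM('a)) * emeasure lborel {x. ennreal m \<le> ennreal_powr (ennreal (1 / \<kappa>) * h x) p}"
    proof (intro mult_left_mono emeasure_mono subsetI CollectI)
      fix x assume "x \<in> {x. ennreal (\<kappa> * l) \<le> h x}"
      then have "ennreal (1 / \<kappa>) * ennreal (\<kappa> * l) \<le> ennreal (1 / \<kappa>) * h x"
        by (intro mult_left_mono) auto
      then show "ennreal m \<le> ennreal_powr (ennreal (1 / \<kappa>) * h x) p"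
        using \<kappa> l by (simp add: ennreal_powr_le_iff[OF p, symmetric] ennreal_mult[symmetric])
    qed auto
    finally show "emeasure lborel {x. ennreal m < ennreal_powr (H x) p}
        \<le> ennreal (40 ^ DIM('a)) * emeasure lborel {x. ennreal m \<le> ennreal_powr (ennreal (1 / \<kappa>) * h x) p}" .
  qed auto
  also have "\<dots> \<le> ennreal (40 ^ DIM('a)) *
      (\<integral>\<^sup>+x. ennreal ((5 powr (1 / q) / \<kappa>) powr p) * ennreal_powr (V x) p \<partial>lborel)"
  proof (intro mult_left_mono nn_integral_mono)
    fix x
    have "ennreal (1 / \<kappa>) * h x \<le> ennreal (1 / \<kappa>) * (ennreal (5 powr (1 / q)) * V x)"
      using h_le by (intro mult_left_mono) auto
    also have "\<dots> = ennreal (5 powr (1 / q) / \<kappa>) * V x"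
      using \<kappa> by (simp add: mult.assoc[symmetric] ennreal_mult[symmetric])
    finally have "ennreal_powr (ennreal (1 / \<kappa>) * h x) p \<le> ennreal_powr (ennreal (5 powr (1 / q) / \<kappa>) * V x) p"
      using p by (intro ennreal_powr_mono) auto
    then show "ennreal_powr (ennreal (1 / \<kappa>) * h x) p
        \<le> ennreal ((5 powr (1 / q) / \<kappa>) powr p) * ennreal_powr (V x) p"
      using \<kappa> by (simp add: ennreal_powr_cmult)
  qed simp
  also have "\<dots> \<le> ennreal (40 ^ DIM('a)) *
      (ennreal ((5 powr (1 / q) / \<kappa>) powr p) * (\<integral>\<^sup>+x. ennreal_powr (V x) p \<partial>lborel))"
    using \<kappa> by (intro mult_left_mono nn_integral_cmult_le) auto
  also have "\<dots> = ennreal (40 ^ DIM('a) * (5 powr (1 / q) / \<kappa>) powr p) * (\<integral>\<^sup>+x. ennreal_powr (V x) p \<partial>lborel)"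
    by (subst ennreal_mult) (auto simp: mult.assoc)
  finally show "(\<integral>\<^sup>+x. ennreal_powr (H x) p \<partial>lborel) \<le> ennreal (40 ^ DIM('a) * (5 powr (1 / q) / \<kappa>) powr p) *
      (\<integral>\<^sup>+x. ennreal_powr (ennreal_powr (\<integral>\<^sup>+t\<in>{0<..}. ennreal_powr (W t x) q * ennreal (1 / t) \<partial>lborel)
        (1 / q)) p \<partial>lborel)"
    unfolding V_def .
qed


subsection \<open>Tent norms\<close>

lemma whitney_mean_measurable:
  fixes f :: "real \<times> 'a::euclidean_space \<Rightarrow> complex"
  assumes "f \<in> borel_measurable (lebesgue_on upper_half_space)"
  obtains W where "(\<lambda>z. W (fst z) (snd z)) \<in> borel_measurable borel"
    "\<And>t x. 0 < t \<Longrightarrow> whitney_mean r \<beta> f t x = W t x"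
proof -
  obtain g :: "real \<times> 'a \<Rightarrow> real" where g: "g \<in> borel_measurable borel" "\<And>w. 0 \<le> g w"
    "AE w in lborel. 0 < fst w \<longrightarrow> norm (of_real (fst w powr (-\<beta>)) * f w) = g w"
    by (rule ex_borel_representative[OF assms, of \<beta>]) (rule that)
  show ?thesis
  proof (rule that)
    show "(\<lambda>z. local_mean r g (whitney_box (fst z) (snd z))) \<in> borel_measurable borel"
      by (rule local_mean_whitney_box_measurable[OF g(1)])
    show "whitney_mean r \<beta> f t x = local_mean r g (whitney_box t x)" if "0 < t" for t x
      by (rule whitney_mean_eq_local_mean[OF assms g(1,3) that])
  qed
qed

text \<open>Serves the case q = \<infinity>, where bounding \<open>esssup\<close> over t from above
  requires a measurable function.\<close>

lemma whitney_mean_measurable_t: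
  assumes f: "f \<in> borel_measurable (lebesgue_on upper_half_space)"
  shows "(\<lambda>t. whitney_mean r \<beta> f t x) \<in> borel_measurable (lebesgue_on {0<..})"
proof -
  obtain W where W [unfolded borel_prod[symmetric], measurable]:
    "(\<lambda>z. W (fst z) (snd z)) \<in> borel_measurable borel"
    and eq: "\<And>t x. 0 < t \<Longrightarrow> whitney_mean r \<beta> f t x = W t x"
    by (rule whitney_mean_measurable[OF f, of r \<beta>]) (rule that)
  have "(\<lambda>t. W (fst (t, x)) (snd (t, x))) \<in> borel_measurable borel"
    by (rule measurable_compose[OF _ W]) measurable
  then have "(\<lambda>t. W t x) \<in> borel_measurable (lebesgue_on {0<..})"
    by (intro measurable_restrict_space1 measurable_completion) simp
  then show ?thesis
    by (subst measurable_cong[where g = "\<lambda>t. W t x"]) (auto simp: eq)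
qed

lemma whitney_mean_mono_exponent:
  fixes f :: "real \<times> 'a::euclidean_space \<Rightarrow> complex"
  assumes f: "f \<in> borel_measurable (lebesgue_on upper_half_space)"
    and "0 < r1" "r1 \<le> r0" "0 < t"
  shows "whitney_mean r1 \<beta> f t x \<le> whitney_mean r0 \<beta> f t x"
proof -
  obtain g :: "real \<times> 'a \<Rightarrow> real" where g: "g \<in> borel_measurable borel" "\<And>w. 0 \<le> g w"
    "AE w in lborel. 0 < fst w \<longrightarrow> norm (of_real (fst w powr (-\<beta>)) * f w) = g w"
    by (rule ex_borel_representative[OF f, of \<beta>]) (rule that)
  show ?thesis
    unfolding whitney_mean_eq_local_mean[OF f g(1,3) \<open>0 < t\<close>]
    using assms g emeasure_whitney_box_pos_finite[of t x] by (intro local_mean_mono_exponent) auto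
qed

text \<open>\<kappa> is fixed before \<beta> and f, since the constant for boxes does not depend on
  the Borel function that absorbs them. This makes the final constant uniform in f.\<close>

lemma whitney_mean_spreading:
  assumes r: "0 < r"
  obtains \<kappa> :: real where "0 < \<kappa>" "\<And>\<beta> f :: real \<times> 'a::euclidean_space \<Rightarrow> complex.
    f \<in> borel_measurable (lebesgue_on upper_half_space) \<Longrightarrow> spreading \<kappa> (whitney_mean r \<beta> f)"
proof (rule local_mean_whitney_box_spread[OF r])
  fix \<kappa> :: real
  assume \<kappa>: "0 < \<kappa>" and spread: "\<And>(g :: real \<times> 'a \<Rightarrow> real) t x l.
      g \<in> borel_measurable borel \<Longrightarrow> 0 < t \<Longrightarrow> 0 < l \<Longrightarrow>
      ennreal l < local_mean r g (whitney_box t x) \<Longrightarrow>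
      \<exists>a c. dist x c \<le> t \<and> 3 * t / 4 \<le> a \<and> a \<le> t \<and>
        (\<forall>s\<in>{a..a + t/4}. \<forall>y\<in>ball c (t/4). ennreal (\<kappa> * l) \<le> local_mean r g (whitney_box s y))"
  show thesis
  proof (rule that[OF \<kappa>])
    fix \<beta> and f :: "real \<times> 'a \<Rightarrow> complex"
    assume f: "f \<in> borel_measurable (lebesgue_on upper_half_space)"
    obtain g :: "real \<times> 'a \<Rightarrow> real" where g: "g \<in> borel_measurable borel" "\<And>w. 0 \<le> g w"
      "AE w in lborel. 0 < fst w \<longrightarrow> norm (of_real (fst w powr (-\<beta>)) * f w) = g w"
      by (rule ex_borel_representative[OF f, of \<beta>]) (rule that)
    note eq = whitney_mean_eq_local_mean[OF f g(1,3)]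
    show "spreading \<kappa> (whitney_mean r \<beta> f)"
      unfolding spreading_def
    proof (intro allI impI)
      fix t l :: real and x :: 'a
      assume t: "0 < t" and l: "0 < l" and less: "ennreal l < whitney_mean r \<beta> f t x"
      obtain a c where ac: "dist x c \<le> t" "3 * t / 4 \<le> a" "a \<le> t"
        and ge: "\<forall>s\<in>{a..a + t/4}. \<forall>y\<in>ball c (t/4). ennreal (\<kappa> * l) \<le> local_mean r g (whitney_box s y)"
        using spread[OF g(1) t l] less eq[OF t] by metis
      have "ennreal (\<kappa> * l) \<le> whitney_mean r \<beta> f s y" if "s \<in> {a..a + t/4}" "y \<in> ball c (t/4)" for s y
      proof -
        have "0 < s" using that ac t by auto
        then show ?thesis using ge that eq by simp
      qed
      then show "\<exists>a c. dist x c \<le> t \<and> 3 * t / 4 \<le> a \<and> a \<le> t \<and>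
          (\<forall>s\<in>{a..a + t/4}. \<forall>y\<in>ball c (t/4). ennreal (\<kappa> * l) \<le> whitney_mean r \<beta> f s y)"
        using ac by blast
    qed
  qed
qed

text \<open>Allows the integral of a sum containing the q0-functional to be split; the q1-functional
  is only ever bounded from above.\<close>

lemma vertical_functional_measurable:
  fixes f :: "real \<times> 'a::euclidean_space \<Rightarrow> complex"
  assumes f: "f \<in> borel_measurable (lebesgue_on upper_half_space)" and q: "q \<noteq> \<infinity>"
  shows "vertical_functional q r \<beta> f \<in> borel_measurable borel"
proof -
  obtain W :: "real \<Rightarrow> 'a \<Rightarrow> ennreal" where W: "(\<lambda>z. W (fst z) (snd z)) \<in> borel_measurable borel"
    and eq: "\<And>t x. 0 < t \<Longrightarrow> whitney_mean r \<beta> f t x = W t x"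
    by (rule whitney_mean_measurable[OF f, of r \<beta>]) (rule that)
  have [measurable]: "(\<lambda>z. W (snd z) (fst z)) \<in> borel_measurable (borel \<Otimes>\<^sub>M borel)"
    using measurable_compose[OF measurable_Pair[OF measurable_snd measurable_fst] W[unfolded borel_prod[symmetric]]]
    by simp
  have "vertical_functional q r \<beta> f = (\<lambda>x. ennreal_powr
      (\<integral>\<^sup>+t\<in>{0<..}. ennreal_powr (W t x) (enn2real q) * ennreal (1 / t) \<partial>lborel) (1 / enn2real q))"
    using q unfolding vertical_functional_def nn_integral_completion
    by (auto simp: fun_eq_iff eq indicator_def intro!: arg_cong2[where f = ennreal_powr] nn_integral_cong)
  moreover have "\<dots> \<in> borel_measurable borel" by measurable
  ultimately show ?thesis by simp
qed

section \<open>Monotonicity in r\<close>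

lemma vertical_functional_mono_exponent:
  assumes f: "f \<in> borel_measurable (lebesgue_on upper_half_space)" and r: "0 < r1" "r1 \<le> r0"
  shows "vertical_functional q r1 \<beta> f x \<le> vertical_functional q r0 \<beta> f x"
proof (cases "q = \<infinity>")
  case True
  then show ?thesis
    using whitney_mean_mono_exponent[OF f r]
    by (auto simp: vertical_functional_def intro!: esssup_AE_mono AE_I2 whitney_mean_measurable_t[OF f])
next
  case False
  then show ?thesis
    using whitney_mean_mono_exponent[OF f r]
    by (auto simp: vertical_functional_def
        intro!: ennreal_powr_mono set_nn_integral_mono mult_right_mono)
qed

lemma tent_norm_mono_exponent:
  assumes f: "f \<in> borel_measurable (lebesgue_on upper_half_space)" and r: "0 < r1" "r1 \<le> r0"
  shows "tent_norm p q r1 \<beta> f \<le> tent_norm p q r0 \<beta> f"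
proof -
  note W = whitney_mean_mono_exponent[OF f r]
  consider "p < \<infinity>" | "p = \<infinity>" "q < \<infinity>" | "p = \<infinity>" "q = \<infinity>"
    using top.not_eq_extremum by fastforce
  then show ?thesis
  proof cases
    case 1
    then show ?thesis
      using vertical_functional_mono_exponent[OF f r]
      by (auto simp: tent_norm_def intro!: ennreal_powr_mono nn_integral_mono)
  next
    case 2
    have "ennreal_powr (\<integral>\<^sup>+t\<in>{0<..<\<tau>}. mean_integral (ball y \<tau>)
        (\<lambda>x. ennreal_powr (whitney_mean r1 \<beta> f t x) (enn2real q)) * ennreal (1 / t) \<partial>lebesgue) (1 / enn2real q)
      \<le> ennreal_powr (\<integral>\<^sup>+t\<in>{0<..<\<tau>}. mean_integral (ball y \<tau>)
        (\<lambda>x. ennreal_powr (whitney_mean r0 \<beta> f t x) (enn2real q)) * ennreal (1 / t) \<partial>lebesgue) (1 / enn2real q)"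
      for \<tau> y
      using W by (auto intro!: ennreal_powr_mono set_nn_integral_mono mult_right_mono mean_integral_mono)
    then show ?thesis
      using 2 by (auto simp: tent_norm_def intro!: SUP_mono' SUP_subset_mono)
  next
    case 3
    then show ?thesis using W by (auto simp: tent_norm_def intro!: SUP_subset_mono)
  qed
qed

section \<open>Raising q at fixed r\<close>

lemma vertical_functional_le:
  assumes f: "f \<in> borel_measurable (lebesgue_on upper_half_space)"
    and q: "0 < q0" "q0 \<noteq> \<infinity>" "q0 \<le> q1"
    and sup: "\<And>t. 0 < t \<Longrightarrow> whitney_mean r \<beta> f t x \<le> m"
    and bound: "vertical_functional q0 r \<beta> f x \<le> m"
  shows "vertical_functional q1 r \<beta> f x \<le> m"
proof (cases "q1 = \<infinity>")
  case True
  then show ?thesis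
    using sup by (simp add: vertical_functional_def)
      (intro esssup_I whitney_mean_measurable_t[OF f] AE_I2, simp)
next
  case False
  have le: "0 < enn2real q0" "enn2real q0 \<le> enn2real q1"
    using q False by (auto simp: enn2real_exponent_pos top.not_eq_extremum intro!: enn2real_mono)
  define \<Phi> where "\<Phi> u = (\<integral>\<^sup>+t\<in>{0<..}. u t * ennreal (1 / t) \<partial>lebesgue)" for u :: "real \<Rightarrow> ennreal"
  have "ennreal_powr (\<Phi> (\<lambda>t. ennreal_powr (whitney_mean r \<beta> f t x) (enn2real q1))) (1 / enn2real q1) \<le> m"
    using _ _ le
  proof (rule functional_powr_bound[where S = "{0<..}" and \<Phi> = \<Phi>])
    show "\<Phi> u \<le> \<Phi> v" if "\<And>t. t \<in> {0<..} \<Longrightarrow> u t \<le> v t" for u v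
      unfolding \<Phi>_def using that by (intro set_nn_integral_mono mult_right_mono) auto
    show "\<Phi> (\<lambda>t. ennreal c * u t) \<le> ennreal c * \<Phi> u" if "0 < c" for c u
      using nn_integral_cmult_le[OF that, of lebesgue "\<lambda>t. u t * ennreal (1 / t) * indicator {0<..} t"]
      by (simp add: \<Phi>_def mult.assoc)
    show "ennreal_powr (\<Phi> (\<lambda>t. ennreal_powr (whitney_mean r \<beta> f t x) (enn2real q0))) (1 / enn2real q0) \<le> m"
      using bound q by (simp add: \<Phi>_def vertical_functional_def)
  qed (use sup in auto)
  then show ?thesis using False by (simp add: \<Phi>_def vertical_functional_def)
qed

lemma tent_norm_le_finite:
  assumes p: "0 < p" "p \<noteq> \<infinity>" and q: "0 < q0" "q0 \<noteq> \<infinity>" "q0 \<le> q1" and r: "0 < r"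
  obtains C where "0 \<le> C" "\<And>f :: real \<times> 'a::euclidean_space \<Rightarrow> complex.
    f \<in> borel_measurable (lebesgue_on upper_half_space) \<Longrightarrow>
    tent_norm p q1 r \<beta> f \<le> ennreal C * tent_norm p q0 r \<beta> f"
proof (rule whitney_mean_spreading[OF r])
  fix \<kappa> :: real
  assume \<kappa>: "0 < \<kappa>" and spread: "\<And>\<beta> f :: real \<times> 'a \<Rightarrow> complex.
    f \<in> borel_measurable (lebesgue_on upper_half_space) \<Longrightarrow> spreading \<kappa> (whitney_mean r \<beta> f)"
  define P where "P = enn2real p"
  define Q where "Q = enn2real q0"
  have PQ: "0 < P" "0 < Q" using p q by (simp_all add: P_def Q_def enn2real_exponent_pos)
  \<comment> \<open>The constant of \<open>spreading_nontangential_bound\<close>. It becomes K + 1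
    below because the q0-functional has to be bounded alongside \<open>H\<close>.\<close>
  define K where "K = 40 ^ DIM('a) * (5 powr (1 / Q) / \<kappa>) powr P"
  have K: "0 \<le> K" by (simp add: K_def)
  show thesis
  proof (rule that)
    show "0 \<le> (K + 1) powr (1 / P)" by simp
    fix f :: "real \<times> 'a \<Rightarrow> complex"
    assume f: "f \<in> borel_measurable (lebesgue_on upper_half_space)"
    define V where "V = vertical_functional q0 r \<beta> f"
    have V [measurable]: "V \<in> borel_measurable borel"
      unfolding V_def using f q by (intro vertical_functional_measurable) auto
    have V_eq: "V = (\<lambda>x. ennreal_powr (\<integral>\<^sup>+t\<in>{0<..}. ennreal_powr (whitney_mean r \<beta> f t x) Q
        * ennreal (1 / t) \<partial>lborel) (1 / Q))"
      using q by (simp add: V_def vertical_functional_def Q_def nn_integral_completion fun_eq_iff)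
    obtain H where H [measurable]: "H \<in> borel_measurable borel"
      and W_le: "\<And>t x. 0 < t \<Longrightarrow> whitney_mean r \<beta> f t x \<le> H x"
      and int: "(\<integral>\<^sup>+x. ennreal_powr (H x) P \<partial>lborel) \<le> ennreal K * (\<integral>\<^sup>+x. ennreal_powr (V x) P \<partial>lborel)"
      by (rule spreading_nontangential_bound[OF spread[OF f] \<kappa> PQ(2,1)])
        (rule that, assumption, assumption, simp only: V_eq K_def)
    have "(\<integral>\<^sup>+x. ennreal_powr (vertical_functional q1 r \<beta> f x) P \<partial>lborel)
        \<le> (\<integral>\<^sup>+x. ennreal_powr (H x) P + ennreal_powr (V x) P \<partial>lborel)"
    proof (rule nn_integral_mono)
      fix x
      \<comment> \<open>Interpolation asks for one number above both the means at all heights over x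
        and the q0-functional at x. The power of a maximum is at most the sum of the powers for
        every P > 0, so P < 1 costs nothing extra.\<close>
      have "vertical_functional q1 r \<beta> f x \<le> max (H x) (V x)"
        using W_le by (intro vertical_functional_le[OF f q]) (auto simp: V_def le_max_iff_disj)
      then have "ennreal_powr (vertical_functional q1 r \<beta> f x) P \<le> ennreal_powr (max (H x) (V x)) P"
        using PQ by (intro ennreal_powr_mono) auto
      also have "\<dots> \<le> ennreal_powr (H x) P + ennreal_powr (V x) P"
        by (simp add: max_def)
      finally show "ennreal_powr (vertical_functional q1 r \<beta> f x) P \<le> ennreal_powr (H x) P + ennreal_powr (V x) P" .
    qed
    also have "\<dots> = (\<integral>\<^sup>+x. ennreal_powr (H x) P \<partial>lborel) + (\<integral>\<^sup>+x. ennreal_powr (V x) P \<partial>lborel)"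
      by (rule nn_integral_add) measurable
    also have "\<dots> \<le> ennreal (K + 1) * (\<integral>\<^sup>+x. ennreal_powr (V x) P \<partial>lborel)"
      using int K by (simp add: distrib_right add_right_mono)
    finally have "ennreal_powr (\<integral>\<^sup>+x. ennreal_powr (vertical_functional q1 r \<beta> f x) P \<partial>lborel) (1 / P)
        \<le> ennreal_powr (ennreal (K + 1) * (\<integral>\<^sup>+x. ennreal_powr (V x) P \<partial>lborel)) (1 / P)"
      using PQ by (intro ennreal_powr_mono) auto
    also have "\<dots> = ennreal ((K + 1) powr (1 / P)) * ennreal_powr (\<integral>\<^sup>+x. ennreal_powr (V x) P \<partial>lborel) (1 / P)"
      using K by (intro ennreal_powr_cmult) simp
    finally show "tent_norm p q1 r \<beta> f \<le> ennreal ((K + 1) powr (1 / P)) * tent_norm p q0 r \<beta> f"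
      using p by (simp add: tent_norm_def V_def P_def nn_integral_completion top.not_eq_extremum)
  qed
qed

lemma tent_norm_le_infinite:
  assumes q: "0 < q0" "q0 \<noteq> \<infinity>" "q0 \<le> q1" and r: "0 < r"
  obtains C where "0 \<le> C" "\<And>f :: real \<times> 'a::euclidean_space \<Rightarrow> complex.
    f \<in> borel_measurable (lebesgue_on upper_half_space) \<Longrightarrow>
    tent_norm \<infinity> q1 r \<beta> f \<le> ennreal C * tent_norm \<infinity> q0 r \<beta> f"
proof (rule whitney_mean_spreading[OF r])
  fix \<kappa> :: real
  assume \<kappa>: "0 < \<kappa>" and spread: "\<And>\<beta> f :: real \<times> 'a \<Rightarrow> complex.
    f \<in> borel_measurable (lebesgue_on upper_half_space) \<Longrightarrow> spreading \<kappa> (whitney_mean r \<beta> f)"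
  define Q where "Q = enn2real q0"
  have Q: "0 < Q" using q by (simp add: Q_def enn2real_exponent_pos)
  \<comment> \<open>The 1 guarantees N \<le> C N, so that C N bounds the q0-Carleson integrals as
    well as the supremum of the means.\<close>
  define C where "C = max 1 ((5 * 8 ^ DIM('a)) powr (1 / Q) / \<kappa>)"
  show thesis
  proof (rule that)
    show "0 \<le> C" by (simp add: C_def)
    fix f :: "real \<times> 'a \<Rightarrow> complex"
    assume f: "f \<in> borel_measurable (lebesgue_on upper_half_space)"
    define N where "N = tent_norm \<infinity> q0 r \<beta> f"
    have carleson: "ennreal_powr (\<integral>\<^sup>+t\<in>{0<..<\<tau>}. mean_integral (ball y \<tau>)
        (\<lambda>x. ennreal_powr (whitney_mean r \<beta> f t x) Q) * ennreal (1 / t) \<partial>lborel) (1 / Q) \<le> N"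
      if "0 < \<tau>" for \<tau> y
      using q that unfolding N_def tent_norm_def nn_integral_completion Q_def
      by (auto simp: top.not_eq_extremum intro!: SUP_upper2[where i = \<tau>] SUP_upper2[where i = y])
    have "N \<le> ennreal C * N"
      using mult_right_mono[of 1 "ennreal C" N] by (simp add: C_def)
    have W_le: "whitney_mean r \<beta> f t x \<le> ennreal C * N" if "0 < t" for t x
    proof -
      have "whitney_mean r \<beta> f t x \<le> ennreal ((5 * 8 ^ DIM('a)) powr (1 / Q) / \<kappa>) * N"
        using spread[OF f] \<kappa> Q carleson that by (rule spreading_le_carleson)
      also have "\<dots> \<le> ennreal C * N"
        by (intro mult_right_mono ennreal_leI) (auto simp: C_def)
      finally show ?thesis .
    qed
    have "tent_norm \<infinity> q1 r \<beta> f \<le> ennreal C * N"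
    proof (cases "q1 = \<infinity>")
      case True
      then show ?thesis
        using W_le by (auto simp: tent_norm_def intro!: SUP_least)
    next
      case False
      have le: "0 < Q" "Q \<le> enn2real q1"
        using q Q False by (auto simp: Q_def top.not_eq_extremum intro!: enn2real_mono)
      have "ennreal_powr (\<integral>\<^sup>+t\<in>{0<..<\<tau>}. mean_integral (ball y \<tau>)
          (\<lambda>x. ennreal_powr (whitney_mean r \<beta> f t x) (enn2real q1)) * ennreal (1 / t) \<partial>lborel)
          (1 / enn2real q1) \<le> ennreal C * N" if \<tau>: "0 < \<tau>" for \<tau> y
      proof -
        \<comment> \<open>The same interpolation as on a vertical line, now for the integral over a
          single Carleson box; the bound is the same for all boxes.\<close>
        define \<Phi> where "\<Phi> u = (\<integral>\<^sup>+t\<in>{0<..<\<tau>}. mean_integral (ball y \<tau>) (\<lambda>x. u (t, x)) * ennreal (1 / t) \<partial>lborel)"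
          for u :: "real \<times> 'a \<Rightarrow> ennreal"
        have "ennreal_powr (\<Phi> (\<lambda>z. ennreal_powr (whitney_mean r \<beta> f (fst z) (snd z)) (enn2real q1)))
            (1 / enn2real q1) \<le> ennreal C * N"
          using _ _ le
        proof (rule functional_powr_bound[where S = "{0<..} \<times> UNIV" and \<Phi> = \<Phi>])
          show "\<Phi> u \<le> \<Phi> v" if "\<And>z. z \<in> {0<..} \<times> UNIV \<Longrightarrow> u z \<le> v z" for u v
            unfolding \<Phi>_def using that
            by (intro set_nn_integral_mono mult_right_mono mean_integral_mono) auto
          show "\<Phi> (\<lambda>z. ennreal c * u z) \<le> ennreal c * \<Phi> u" if c: "0 < c" for c u
          proof -
            have "\<Phi> (\<lambda>z. ennreal c * u z) \<le> (\<integral>\<^sup>+t. ennreal c *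
                (mean_integral (ball y \<tau>) (\<lambda>x. u (t, x)) * ennreal (1 / t) * indicator {0<..<\<tau>} t) \<partial>lborel)"
              unfolding \<Phi>_def mult.assoc[symmetric]
              by (intro nn_integral_mono mult_right_mono mean_integral_cmult_le c) auto
            also have "\<dots> \<le> ennreal c * \<Phi> u"
              unfolding \<Phi>_def by (rule nn_integral_cmult_le[OF c])
            finally show ?thesis .
          qed
          show "ennreal_powr (\<Phi> (\<lambda>z. ennreal_powr (whitney_mean r \<beta> f (fst z) (snd z)) Q)) (1 / Q) \<le> ennreal C * N"
            using order_trans[OF carleson[OF \<tau>] \<open>N \<le> ennreal C * N\<close>] by (simp add: \<Phi>_def)
        qed (use W_le in auto)
        then show ?thesis by (simp add: \<Phi>_def)
      qed
      then show ?thesis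
        using False by (auto simp: tent_norm_def nn_integral_completion
            top.not_eq_extremum intro!: SUP_least)
    qed
    then show "tent_norm \<infinity> q1 r \<beta> f \<le> ennreal C * tent_norm \<infinity> q0 r \<beta> f"
      by (simp add: N_def)
  qed
qed

lemma tent_norm_le:
  assumes "0 < p" and "0 < q0" and "q0 \<le> q1" and "0 < r"
  obtains C where "0 \<le> C" "\<And>f :: real \<times> 'a::euclidean_space \<Rightarrow> complex.
    f \<in> borel_measurable (lebesgue_on upper_half_space) \<Longrightarrow>
    tent_norm p q1 r \<beta> f \<le> ennreal C * tent_norm p q0 r \<beta> f"
proof -
  consider "q0 = \<infinity>" | "q0 \<noteq> \<infinity>" "p = \<infinity>" | "q0 \<noteq> \<infinity>" "p \<noteq> \<infinity>" by blast
  then show ?thesis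
  proof cases
    case 1
    then have "q1 = q0" using assms by (simp add: top_unique)
    then show ?thesis by (intro that[of 1]) auto
  next
    case 2
    show ?thesis
      by (rule tent_norm_le_infinite[OF assms(2) 2(1) assms(3,4), of \<beta>]) (rule that, auto simp: 2(2))
  next
    case 3
    show ?thesis
      by (rule tent_norm_le_finite[OF assms(1) 3(2) assms(2) 3(1) assms(3,4), of \<beta>]) (rule that)
  qed
qed

theorem lemma3p20:
  fixes p q0 q1 r0 r1 :: ennreal and \<beta> :: real
  assumes "0 < p" and "0 < q0" and "q0 \<le> q1" and "0 < r1" and "r1 \<le> r0"
  shows "continuously_embedded
    (tent_space p q0 r0 \<beta> :: (real \<times> 'a::euclidean_space \<Rightarrow> complex) set) (tent_norm p q0 r0 \<beta>)
    (tent_space p q1 r1 \<beta>) (tent_norm p q1 r1 \<beta>)"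
proof -
  obtain C where C: "0 \<le> C" "\<And>f :: real \<times> 'a \<Rightarrow> complex.
    f \<in> borel_measurable (lebesgue_on upper_half_space) \<Longrightarrow>
    tent_norm p q1 r1 \<beta> f \<le> ennreal C * tent_norm p q0 r1 \<beta> f"
    by (rule tent_norm_le[OF assms(1-4)]) (rule that)
  \<comment> \<open>q is raised at the exponent r1; afterwards r1 is replaced by r0 in the norm on
    the right, which costs no factor.\<close>
  have le: "tent_norm p q1 r1 \<beta> f \<le> ennreal C * tent_norm p q0 r0 \<beta> f"
    if f: "f \<in> borel_measurable (lebesgue_on upper_half_space)" for f :: "real \<times> 'a \<Rightarrow> complex"
    using C(2)[OF f] mult_left_mono[OF tent_norm_mono_exponent[OF f assms(4,5)], of "ennreal C" p q0 \<beta>]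
    by (meson order_trans zero_le)
  show ?thesis
    unfolding continuously_embedded_def
  proof (intro conjI exI[of _ C] ballI subsetI)
    fix f :: "real \<times> 'a \<Rightarrow> complex" assume f: "f \<in> tent_space p q0 r0 \<beta>"
    then show "tent_norm p q1 r1 \<beta> f \<le> ennreal C * tent_norm p q0 r0 \<beta> f"
      by (simp add: tent_space_def le)
    also have "\<dots> < \<infinity>" using f by (simp add: tent_space_def ennreal_mult_less_top)
    finally show "f \<in> tent_space p q1 r1 \<beta>" using f by (simp add: tent_space_def)
  qed
qed

end
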